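(* Let $a,c,y\in\mathbb{R}$ satisfy $c<0<a$, $2c+a<0$, $c<-a-c<a$ and $y\in[c,-a-c]$, and let $x_0$, $w_1$, $w_2$ be the functions defined in the context from $a,c,y$. Let $\{B(t)\}_{t\ge0}$ be a one-dimensional standard Brownian motion on a complete probability space $(\Omega,\mathcal{F},\mathbb{P})$ with Brownian filtration $\{\mathcal{F}^B_t\}_{t\ge 0}$. Then the stochastic differential equation $$\ddot x_1(t)=2x_0(t)x_1(t)+\dot B(t),\qquad x_1(0)=0,\quad \dot x_1(0)=0,$$ has a unique global (i.e. defined for all $t\ge0$) strong solution adapted to $\{\mathcal{F}^B_t\}_{t\ge0}$. The solution is a continuous Gaussian process which can be represented as $$x_1(t)=w_2(t)\int_0^t w_1(s)\,dB(s)-w_1(t)\int_0^t w_2(s)\,dB(s),$$ or equivalently $$x_1(t)=\int_0^t\mathcal{K}(t,s)\,dB(s)\quad\text{with}\quad \mathcal{K}(t,s):=w_2(t)w_1(s)-w_1(t)w_2(s).$$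
   Context: The second order equation is understood as the system $dx_1(t)=\xi_1(t)\,dt$, $x_1(0)=0$; $d\xi_1(t)=2x_0(t)x_1(t)\,dt+dB(t)$, $\xi_1(0)=0$ (so $\dot x_1(t)=2\int_0^t x_0(s)x_1(s)\,ds+B(t)$ almost surely). Let $q:=\sqrt{\frac{2c+a}{c-a}}\in(0,1)$, $F(\gamma,q):=\int_0^\gamma\frac{d\alpha}{\sqrt{1-q^2\sin^2\alpha}}$, $i_y:=F\big(\arcsin\sqrt{\frac{c-y}{2c+a}},q\big)$, and let $\mathrm{sn},\mathrm{cn},\mathrm{dn}$ be the Jacobi elliptic functions (second argument = modulus $q$). Set $$x_0(t):=c-(a+2c)\,\mathrm{sn}^2\Big(\sqrt{\tfrac{a-c}{6}}\,t+i_y,q\Big).$$ Let $\mathcal{E}(t,q):=\int_0^t\mathrm{dn}^2(s,q)\,ds$ (Jacobi's Epsilon function) and $$u_1(t):=\mathrm{sn}(t,q)\,\mathrm{cn}(t,q)\,\mathrm{dn}(t,q),$$ $$u_2(t):=\alpha_0+\alpha_1\mathrm{cn}^2(t,q)+\alpha_2\mathrm{cn}^4(t,q)+\big(\beta_0t+\beta_1\mathcal{E}(t,q)\big)u_1(t),$$ with $\alpha_0=-1+q^2$, $\alpha_1=-2q^6+3q^4-5q^2+2$, $\alpha_2=2q^2(q^4-q^2+1)$, $\beta_0=-q^4+3q^2-2$, $\beta_1=2(q^4-q^2+1)$. The functions $w_i(t):=\kappa_i\,u_i\big(\sqrt{\tfrac{a-c}{6}}\,t+i_y\big)$, $i=1,2$,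 where $\kappa_1,\kappa_2$ are fixed nonzero real constants chosen so that the Wronskian is normalized, $w_1\dot w_2-\dot w_1w_2=1$, are two linearly independent solutions of $\ddot w(t)-2x_0(t)w(t)=0$. *)

theory Defs
  imports "HOL-Probability.Probability"
begin

section \<open>Jacobi elliptic functions of a real argument, with modulus \<open>q\<close>\<close>

definition elliptic_F :: "real \<Rightarrow> real \<Rightarrow> real" where
  "elliptic_F \<gamma> q = (LBINT \<alpha>=0..\<gamma>. 1 / sqrt (1 - q\<^sup>2 * (sin \<alpha>)\<^sup>2))"

text \<open>For \<open>0 < q < 1\<close> the map \<open>\<lambda>\<gamma>. elliptic_F \<gamma> q\<close> is an increasing bijection of the
  real line; the amplitude is its inverse. For other moduli the value may be unspecified.\<close>

definition jacobi_am :: "real \<Rightarrow> real \<Rightarrow> real" where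
  "jacobi_am u q = (THE \<phi>. elliptic_F \<phi> q = u)"

definition jacobi_sn :: "real \<Rightarrow> real \<Rightarrow> real" where
  "jacobi_sn u q = sin (jacobi_am u q)"

definition jacobi_cn :: "real \<Rightarrow> real \<Rightarrow> real" where
  "jacobi_cn u q = cos (jacobi_am u q)"

definition jacobi_dn :: "real \<Rightarrow> real \<Rightarrow> real" where
  "jacobi_dn u q = sqrt (1 - q\<^sup>2 * (jacobi_sn u q)\<^sup>2)"

definition jacobi_Epsilon :: "real \<Rightarrow> real \<Rightarrow> real" where
  "jacobi_Epsilon t q = (LBINT s=0..t. (jacobi_dn s q)\<^sup>2)"


section \<open>The coefficient \<open>x\<^sub>0\<close> and the functions \<open>w\<^sub>1\<close>, \<open>w\<^sub>2\<close>\<close>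

definition modulus_q :: "real \<Rightarrow> real \<Rightarrow> real" where
  "modulus_q a c = sqrt ((2 * c + a) / (c - a))"

definition i_y :: "real \<Rightarrow> real \<Rightarrow> real \<Rightarrow> real" where
  "i_y a c y = elliptic_F (arcsin (sqrt ((c - y) / (2 * c + a)))) (modulus_q a c)"

definition x0 :: "real \<Rightarrow> real \<Rightarrow> real \<Rightarrow> real \<Rightarrow> real" where
  "x0 a c y t = c - (a + 2 * c) *
     (jacobi_sn (sqrt ((a - c) / 6) * t + i_y a c y) (modulus_q a c))\<^sup>2"

definition u1 :: "real \<Rightarrow> real \<Rightarrow> real" where
  "u1 q t = jacobi_sn t q * jacobi_cn t q * jacobi_dn t q"

definition u2 :: "real \<Rightarrow> real \<Rightarrow> real" where
  "u2 q t =
    (let \<alpha>\<^sub>0 = -1 + q^2;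
         \<alpha>\<^sub>1 = -2 * q^6 + 3 * q^4 - 5 * q^2 + 2;
         \<alpha>\<^sub>2 = 2 * q^2 * (q^4 - q^2 + 1);
         \<beta>\<^sub>0 = - (q^4) + 3 * q^2 - 2;
         \<beta>\<^sub>1 = 2 * (q^4 - q^2 + 1)
     in \<alpha>\<^sub>0 + \<alpha>\<^sub>1 * (jacobi_cn t q)^2 + \<alpha>\<^sub>2 * (jacobi_cn t q)^4
        + (\<beta>\<^sub>0 * t + \<beta>\<^sub>1 * jacobi_Epsilon t q) * u1 q t)"

definition w1 :: "real \<Rightarrow> real \<Rightarrow> real \<Rightarrow> real \<Rightarrow> real \<Rightarrow> real" where
  "w1 \<kappa>\<^sub>1 a c y t = \<kappa>\<^sub>1 * u1 (modulus_q a c) (sqrt ((a - c) / 6) * t + i_y a c y)"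

definition w2 :: "real \<Rightarrow> real \<Rightarrow> real \<Rightarrow> real \<Rightarrow> real \<Rightarrow> real" where
  "w2 \<kappa>\<^sub>2 a c y t = \<kappa>\<^sub>2 * u2 (modulus_q a c) (sqrt ((a - c) / 6) * t + i_y a c y)"


section \<open>Processes indexed by \<open>t \<ge> 0\<close>\<close>

text \<open>A process is a function of type \<open>real \<Rightarrow> 'a \<Rightarrow> real\<close>; its values at negative times
  are never used.\<close>

definition continuous_process :: "'a measure \<Rightarrow> (real \<Rightarrow> 'a \<Rightarrow> real) \<Rightarrow> bool" where
  "continuous_process M X \<longleftrightarrow> (AE \<omega> in M. continuous_on {0..} (\<lambda>t. X t \<omega>))"

definition adapted_process :: "(real \<Rightarrow> 'a measure) \<Rightarrow> (real \<Rightarrow> 'a \<Rightarrow> real) \<Rightarrow> bool" where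
  "adapted_process F X \<longleftrightarrow> (\<forall>t\<ge>0. X t \<in> borel_measurable (F t))"

definition brownian_motion :: "'a measure \<Rightarrow> (real \<Rightarrow> 'a \<Rightarrow> real) \<Rightarrow> bool" where
  "brownian_motion M B \<longleftrightarrow>
     (\<forall>t\<ge>0. B t \<in> borel_measurable M) \<and>
     (AE \<omega> in M. B 0 \<omega> = 0) \<and>
     (\<forall>n \<tau>. 0 \<le> \<tau> 0 \<and> (\<forall>i<n. \<tau> i < \<tau> (Suc i)) \<longrightarrow>
        prob_space.indep_vars M (\<lambda>_. borel)
          (\<lambda>i \<omega>. B (\<tau> (Suc i)) \<omega> - B (\<tau> i) \<omega>) {..<n::nat}) \<and>
     (\<forall>s t. 0 \<le> s \<and> s < t \<longrightarrow>
        distributed M lborel (\<lambda>\<omega>. B t \<omega> - B s \<omega>) (normal_density 0 (sqrt (t - s)))) \<and>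
     continuous_process M B"

text \<open>The Brownian filtration is the natural filtration augmented by the null sets.\<close>

definition brownian_filtration :: "'a measure \<Rightarrow> (real \<Rightarrow> 'a \<Rightarrow> real) \<Rightarrow> real \<Rightarrow> 'a measure" where
  "brownian_filtration M B t =
     sigma (space M)
       ((\<Union>s\<in>{0..t}. {B s -` A \<inter> space M | A. A \<in> sets borel}) \<union> null_sets M)"

text \<open>Constants count as (degenerate) Gaussian random variables. A process is Gaussian iff
  its finite-dimensional marginals are Gaussian vectors, i.e. all finite linear
  combinations of its values are Gaussian.\<close>

definition gaussian_rv :: "'a measure \<Rightarrow> ('a \<Rightarrow> real) \<Rightarrow> bool" where
  "gaussian_rv M Z \<longleftrightarrow>
     Z \<in> borel_measurable M \<and>
     ((\<exists>\<mu> \<sigma>. \<sigma> > 0 \<and> distributed M lborel Z (normal_density \<mu> \<sigma>)) \<or>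
      (\<exists>\<mu>. AE \<omega> in M. Z \<omega> = \<mu>))"

definition gaussian_process :: "'a measure \<Rightarrow> (real \<Rightarrow> 'a \<Rightarrow> real) \<Rightarrow> bool" where
  "gaussian_process M X \<longleftrightarrow>
     (\<forall>I c. finite I \<and> I \<subseteq> {0..} \<longrightarrow> gaussian_rv M (\<lambda>\<omega>. \<Sum>t\<in>I. c t * X t \<omega>))"


section \<open>It\^o integral of square-integrable integrands\<close>

text \<open>An elementary integrand on \<open>[0, T]\<close> is
  \<open>\<Sum>i<n. e i \<omega> * indicator {\<tau> i..<\<tau> (Suc i)} s\<close> with
  \<open>0 = \<tau> 0 \<le> \<dots> \<le> \<tau> n = T\<close> and each \<open>e i\<close> bounded and \<open>F (\<tau> i)\<close>-measurable.\<close>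

definition elementary_data ::
  "'a measure \<Rightarrow> (real \<Rightarrow> 'a measure) \<Rightarrow> real \<Rightarrow> nat \<Rightarrow> (nat \<Rightarrow> real) \<Rightarrow> (nat \<Rightarrow> 'a \<Rightarrow> real) \<Rightarrow> bool"
where
  "elementary_data M F T n \<tau> e \<longleftrightarrow>
     \<tau> 0 = 0 \<and> \<tau> n = T \<and> (\<forall>i<n. \<tau> i \<le> \<tau> (Suc i)) \<and>
     (\<forall>i<n. e i \<in> borel_measurable (F (\<tau> i)) \<and> (\<exists>C. \<forall>\<omega>\<in>space M. \<bar>e i \<omega>\<bar> \<le> C))"

definition elementary_integrand ::
  "nat \<Rightarrow> (nat \<Rightarrow> real) \<Rightarrow> (nat \<Rightarrow> 'a \<Rightarrow> real) \<Rightarrow> real \<Rightarrow> 'a \<Rightarrow> real" where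
  "elementary_integrand n \<tau> e s \<omega> = (\<Sum>i<n. e i \<omega> * indicator {\<tau> i..<\<tau> (Suc i)} s)"

definition elementary_integral ::
  "(real \<Rightarrow> 'a \<Rightarrow> real) \<Rightarrow> nat \<Rightarrow> (nat \<Rightarrow> real) \<Rightarrow> (nat \<Rightarrow> 'a \<Rightarrow> real) \<Rightarrow> 'a \<Rightarrow> real" where
  "elementary_integral B n \<tau> e \<omega> = (\<Sum>i<n. e i \<omega> * (B (\<tau> (Suc i)) \<omega> - B (\<tau> i) \<omega>))"

text \<open>\<open>has_ito_integral M F B T H I\<close>: the integrand \<open>H\<close> is jointly measurable, adapted and
  square-integrable on \<open>[0, T] \<times> \<Omega>\<close>, and the random variable \<open>I\<close> is (a version of) the
  integral of \<open>H\<close> with respect to \<open>B\<close> over \<open>[0, T]\<close>, that is, the mean-square limit of the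
  integrals of elementary integrands converging to \<open>H\<close> in mean square. By the It\^o
  isometry \<open>I\<close> is almost surely unique and independent of the approximating sequence.\<close>

definition has_ito_integral ::
  "'a measure \<Rightarrow> (real \<Rightarrow> 'a measure) \<Rightarrow> (real \<Rightarrow> 'a \<Rightarrow> real) \<Rightarrow> real \<Rightarrow>
   (real \<Rightarrow> 'a \<Rightarrow> real) \<Rightarrow> ('a \<Rightarrow> real) \<Rightarrow> bool" where
  "has_ito_integral M F B T H I \<longleftrightarrow>
     (\<lambda>(s, \<omega>). indicator {0..T} s * H s \<omega>) \<in> borel_measurable (lborel \<Otimes>\<^sub>M M) \<and>
     (\<forall>s\<in>{0..T}. H s \<in> borel_measurable (F s)) \<and>
     (\<integral>\<^sup>+\<omega>. (\<integral>\<^sup>+s\<in>{0..T}. ennreal ((H s \<omega>)\<^sup>2) \<partial>lborel) \<partial>M) < \<infinity> \<and>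
     I \<in> borel_measurable M \<and>
     (\<exists>n \<tau> e.
        (\<forall>k::nat. elementary_data M F T (n k) (\<tau> k) (e k)) \<and>
        (\<lambda>k. \<integral>\<^sup>+\<omega>. (\<integral>\<^sup>+s\<in>{0..T}.
            ennreal ((H s \<omega> - elementary_integrand (n k) (\<tau> k) (e k) s \<omega>)\<^sup>2) \<partial>lborel) \<partial>M)
          \<longlonglongrightarrow> 0 \<and>
        (\<lambda>k. \<integral>\<^sup>+\<omega>. ennreal ((I \<omega> - elementary_integral B (n k) (\<tau> k) (e k) \<omega>)\<^sup>2) \<partial>M)
          \<longlonglongrightarrow> 0)"

text \<open>The process \<open>\<lambda>t. \<integral>\<^sub>0\<^sup>t H dB\<close>, as usual in its adapted continuous version (unique up to
  indistinguishability).\<close>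

definition ito_integral_process ::
  "'a measure \<Rightarrow> (real \<Rightarrow> 'a measure) \<Rightarrow> (real \<Rightarrow> 'a \<Rightarrow> real) \<Rightarrow>
   (real \<Rightarrow> 'a \<Rightarrow> real) \<Rightarrow> (real \<Rightarrow> 'a \<Rightarrow> real) \<Rightarrow> bool" where
  "ito_integral_process M F B H J \<longleftrightarrow>
     adapted_process F J \<and> continuous_process M J \<and>
     (\<forall>t\<ge>0. has_ito_integral M F B t H (J t))"


section \<open>Strong solutions\<close>

text \<open>A global strong solution \<open>(X, V)\<close> of \<open>dX = V dt\<close>, \<open>dV = 2 g X dt + dB\<close>, \<open>X 0 = V 0 = 0\<close>,
  the first-order system for \<open>X'' = 2 g X + B'\<close>.\<close>

definition strong_solution ::
  "'a measure \<Rightarrow> (real \<Rightarrow> 'a measure) \<Rightarrow> (real \<Rightarrow> 'a \<Rightarrow> real) \<Rightarrow> (real \<Rightarrow> real) \<Rightarrow>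
   (real \<Rightarrow> 'a \<Rightarrow> real) \<Rightarrow> (real \<Rightarrow> 'a \<Rightarrow> real) \<Rightarrow> bool" where
  "strong_solution M F B g X V \<longleftrightarrow>
     adapted_process F X \<and> adapted_process F V \<and>
     continuous_process M X \<and> continuous_process M V \<and>
     (AE \<omega> in M. X 0 \<omega> = 0 \<and> V 0 \<omega> = 0) \<and>
     (AE \<omega> in M. \<forall>t\<ge>0.
        X t \<omega> = (LBINT s=0..t. V s \<omega>) \<and>
        V t \<omega> = (LBINT s=0..t. 2 * g s * X s \<omega>) + B t \<omega>)"

end

theory Submission
  imports Defs
begin

text \<open>
The functions \<open>w1\<close> and \<open>w2\<close> are rescaled solutions of a Lame equation, hence a fundamental system of
\<open>w'' = 2 x0 w\<close>; the explicit second solution \<open>u2\<close> satisfies it because of a polynomial identity between the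
squares of the Jacobi functions (\<open>lame_identity\<close>, \<open>lame_fundamental_system\<close>). From there on only the fundamental
system and its Wronskian matter, and the result holds for any such linear equation
(\<open>linear_second_order_sde\<close>).

Since the noise is additive and the integrands are deterministic and continuously differentiable, the stochastic equation
can be solved path by path. Integration by parts defines \<open>\<integral>\<^sub>0\<^sup>t f dB\<close> as \<open>f t * B t - \<integral>\<^sub>0\<^sup>t f' s * B s ds\<close>, and
with this reading of the stochastic integrals the formula for \<open>x\<^sub>1\<close> is variation of constants for the
integral equations, valid for every continuous path (\<open>variation_of_constants\<close>). The difference of two
solutions solves the homogeneous equation, where constancy of the Wronskians forces it to vanish
(\<open>homogeneous_zero\<close>).

It remains to see that the pathwise integral is the Ito integral and that it is Gaussian. Riemann sums
converge to it on every continuous path (\<open>riemann_ito_tendsto\<close>). The difference between a Riemann sum and one on a finer grid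
is a combination of independent increments with small coefficients, so its second moment is small
uniformly in the refinement; Fatou's lemma then gives convergence in mean square
(\<open>wiener_riemann_mean_square\<close>). Finally, all values of the solution are almost sure limits of linear
combinations of values of \<open>B\<close>, and a limit of centred Gaussian variables is Gaussian by convergence of
characteristic functions (\<open>centred_normal_limit\<close>).
\<close>

section \<open>Gaussian combinations of Brownian values and their limits\<close>

lemma char_normal:
  assumes "0 < \<sigma>"
  shows "char (density lborel (normal_density 0 \<sigma>)) t = complex_of_real (exp (- (\<sigma>\<^sup>2 * t\<^sup>2) / 2))"
proof -
  interpret S: prob_space std_normal_distribution
    by (rule prob_space_normal_density) simp
  have "distributed std_normal_distribution lborel (\<lambda>x. x) (normal_density 0 1)"
    by (auto simp: distributed_def distr_id2 prob_space_normal_density)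
  from S.normal_density_affine[OF this, of \<sigma> 0] assms
  have "distributed std_normal_distribution lborel (\<lambda>x. \<sigma> * x) (normal_density 0 \<sigma>)"
    by simp
  then have eq: "density lborel (normal_density 0 \<sigma>) = distr std_normal_distribution lborel (\<lambda>x. \<sigma> * x)"
    by (simp add: distributed_def)
  have "char (density lborel (normal_density 0 \<sigma>)) t = char std_normal_distribution (\<sigma> * t)"
    unfolding eq char_def by (subst integral_distr) (auto simp: mult_ac)
  then show ?thesis
    by (simp add: char_std_normal_distribution power_mult_distrib)
qed

context prob_space begin

text \<open>The degenerate case \<open>v = 0\<close> belongs to the notion: a linear combination of Brownian values may
vanish, and the class becomes closed under almost sure limits.\<close>

definition centred_normal :: "('a \<Rightarrow> real) \<Rightarrow> real \<Rightarrow> bool" where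
  "centred_normal Z v \<longleftrightarrow> Z \<in> borel_measurable M \<and>
     ((v = 0 \<and> (AE \<omega> in M. Z \<omega> = 0)) \<or>
      (0 < v \<and> distributed M lborel Z (normal_density 0 (sqrt v))))"

lemma centred_normal_imp_gaussian_rv: "centred_normal Z v \<Longrightarrow> gaussian_rv M Z"
  unfolding centred_normal_def gaussian_rv_def using real_sqrt_gt_zero by blast

lemma centred_normal_AE_cong:
  assumes "centred_normal Z v" "AE \<omega> in M. Z \<omega> = Y \<omega>" "Y \<in> borel_measurable M"
  shows "centred_normal Y v"
proof -
  have [measurable]: "Z \<in> borel_measurable M" using assms by (simp add: centred_normal_def)
  note assms(3)[measurable]
  have "distr M lborel Z = distr M lborel Y"
    by (rule distr_cong_AE) (use assms in auto)
  then have D: "distributed M lborel Z f \<Longrightarrow> distributed M lborel Y f" for f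
    by (simp add: distributed_def)
  have N: "AE \<omega> in M. Y \<omega> = 0" if "AE \<omega> in M. Z \<omega> = 0"
    using that assms(2) by eventually_elim simp
  show ?thesis using assms(1) unfolding centred_normal_def
    by (elim conjE disjE) (simp_all add: D N)
qed

lemma centred_normal_second_moment:
  assumes "centred_normal Z v"
  shows "(\<integral>\<^sup>+\<omega>. ennreal ((Z \<omega>)\<^sup>2) \<partial>M) = ennreal v"
proof -
  have [measurable]: "Z \<in> borel_measurable M" using assms by (simp add: centred_normal_def)
  consider "v = 0" "AE \<omega> in M. Z \<omega> = 0"
    | "0 < v" "distributed M lborel Z (normal_density 0 (sqrt v))"
    using assms by (auto simp: centred_normal_def)
  then show ?thesis
  proof cases
    case 1
    have "(\<integral>\<^sup>+\<omega>. ennreal ((Z \<omega>)\<^sup>2) \<partial>M) = (\<integral>\<^sup>+\<omega>. 0 \<partial>M)"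
      by (intro nn_integral_cong_AE) (use 1 in auto)
    then show ?thesis using 1 by simp
  next
    case 2
    have sv: "0 < sqrt v" using 2 by simp
    have "integrable M (\<lambda>\<omega>. (Z \<omega>)\<^sup>2)"
      using distributed_integrable[OF 2(2), of "\<lambda>x. x\<^sup>2"]
        integrable_normal_moment[OF sv, of 0 2] by simp
    then have "(\<integral>\<^sup>+\<omega>. ennreal ((Z \<omega>)\<^sup>2) \<partial>M) = ennreal (expectation (\<lambda>\<omega>. (Z \<omega>)\<^sup>2))"
      by (intro nn_integral_eq_integral) auto
    also have "expectation (\<lambda>\<omega>. (Z \<omega>)\<^sup>2) = v"
      using normal_distributed_variance[OF sv 2(2)] normal_distributed_expectation[OF sv 2(2)] 2(1)
      by simp
    finally show ?thesis .
  qed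
qed

lemma expectation_iexp_centred_normal:
  assumes "centred_normal Z v"
  shows "expectation (\<lambda>\<omega>. iexp (t * Z \<omega>)) = complex_of_real (exp (- (v * t\<^sup>2) / 2))"
proof -
  have [measurable]: "Z \<in> borel_measurable M" using assms by (simp add: centred_normal_def)
  consider "v = 0" "AE \<omega> in M. Z \<omega> = 0"
    | "0 < v" "distributed M lborel Z (normal_density 0 (sqrt v))"
    using assms by (auto simp: centred_normal_def)
  then show ?thesis
  proof cases
    case 1
    have "expectation (\<lambda>\<omega>. iexp (t * Z \<omega>)) = expectation (\<lambda>\<omega>. 1)"
      by (intro integral_cong_AE) (use 1 in auto)
    then show ?thesis using 1 by (simp add: prob_space)
  next
    case 2
    have "expectation (\<lambda>\<omega>. iexp (t * Z \<omega>)) = char (distr M lborel Z) t"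
      unfolding char_def by (subst integral_distr) auto
    also have "distr M lborel Z = density lborel (normal_density 0 (sqrt v))"
      using 2 by (simp add: distributed_def)
    finally show ?thesis using 2 by (simp add: char_normal)
  qed
qed

text \<open>Dominated convergence makes the characteristic functions \<open>exp (- v k * t\<^sup>2 / 2)\<close> converge to that
of \<open>Y\<close>. The limit is continuous with value \<open>1\<close> at \<open>0\<close>, hence does not vanish at some \<open>t0 > 0\<close>, and taking
logarithms there shows that the variances converge. Thus \<open>Y\<close> has the characteristic function of a
normal law, and Levy's uniqueness theorem identifies its distribution.\<close>

lemma centred_normal_limit:
  assumes Zk: "\<And>k. centred_normal (Z k) (v k)"
    and lim: "AE \<omega> in M. (\<lambda>k. Z k \<omega>) \<longlonglongrightarrow> Y \<omega>"
    and [measurable]: "Y \<in> borel_measurable M"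
  shows "\<exists>v. centred_normal Y v"
proof -
  have [measurable]: "\<And>k. Z k \<in> borel_measurable M" using Zk by (simp add: centred_normal_def)
  have v0: "v k \<ge> 0" for k using Zk[of k] by (auto simp: centred_normal_def)
  define \<phi> where "\<phi> = char (distr M borel Y)"
  interpret D: real_distribution "distr M borel Y"
    by (rule real_distribution_distr) simp
  have conv: "(\<lambda>k. complex_of_real (exp (- (v k * t\<^sup>2) / 2))) \<longlonglongrightarrow> \<phi> t" for t
  proof -
    have "(\<lambda>k. expectation (\<lambda>\<omega>. iexp (t * Z k \<omega>))) \<longlonglongrightarrow> expectation (\<lambda>\<omega>. iexp (t * Y \<omega>))"
    proof (rule integral_dominated_convergence[where w="\<lambda>_. 1"])
      show "AE \<omega> in M. (\<lambda>k. iexp (t * Z k \<omega>)) \<longlonglongrightarrow> iexp (t * Y \<omega>)"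
        using lim by eventually_elim (intro tendsto_intros)
    qed auto
    also have "expectation (\<lambda>\<omega>. iexp (t * Y \<omega>)) = \<phi> t"
      unfolding \<phi>_def char_def by (subst integral_distr) auto
    finally show ?thesis by (simp only: expectation_iexp_centred_normal[OF Zk])
  qed
  have "\<phi> 0 = 1" unfolding \<phi>_def by (rule D.char_zero)
  have "isCont \<phi> 0" unfolding \<phi>_def by (rule D.isCont_char)
  then have "\<phi> \<midarrow>0\<rightarrow> 1" using \<open>\<phi> 0 = 1\<close> by (simp add: isCont_def)
  then have "eventually (\<lambda>t. \<phi> t \<noteq> 0) (at 0)"
    by (rule tendsto_imp_eventually_ne) simp
  then obtain d where d: "d > 0" "\<And>t. t \<noteq> 0 \<Longrightarrow> dist t 0 < d \<Longrightarrow> \<phi> t \<noteq> 0"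
    by (auto simp: eventually_at)
  define t0 where "t0 = d / 2"
  have t0: "t0 > 0" "\<phi> t0 \<noteq> 0" using d by (auto simp: t0_def)
  define L where "L = Re (\<phi> t0)"
  have reL: "(\<lambda>k. exp (- (v k * t0\<^sup>2) / 2)) \<longlonglongrightarrow> L"
    using tendsto_Re[OF conv[of t0]] by (simp add: L_def)
  have "(\<lambda>k. complex_of_real (exp (- (v k * t0\<^sup>2) / 2))) \<longlonglongrightarrow> complex_of_real L"
    using reL by (rule tendsto_of_real)
  then have "\<phi> t0 = complex_of_real L" using LIMSEQ_unique conv by blast
  then have "L \<noteq> 0" using t0 by auto
  moreover have "L \<ge> 0" by (rule LIMSEQ_le_const[OF reL]) auto
  ultimately have "L > 0" by simp
  have "(\<lambda>k. ln (exp (- (v k * t0\<^sup>2) / 2))) \<longlonglongrightarrow> ln L"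
    using reL \<open>L \<noteq> 0\<close> by (rule tendsto_ln)
  then have "(\<lambda>k. ln (exp (- (v k * t0\<^sup>2) / 2)) * (- 2 / t0\<^sup>2)) \<longlonglongrightarrow> ln L * (- 2 / t0\<^sup>2)"
    by (rule tendsto_mult_right)
  moreover have "(\<lambda>k. ln (exp (- (v k * t0\<^sup>2) / 2)) * (- 2 / t0\<^sup>2)) = v"
    using t0 by (auto simp: field_simps)
  ultimately obtain V where V: "v \<longlonglongrightarrow> V" by auto
  then have "V \<ge> 0" using v0 by (intro LIMSEQ_le_const) auto
  have \<phi>: "\<phi> t = complex_of_real (exp (- (V * t\<^sup>2) / 2))" for t
  proof (rule LIMSEQ_unique[OF conv])
    show "(\<lambda>k. complex_of_real (exp (- (v k * t\<^sup>2) / 2))) \<longlonglongrightarrow> complex_of_real (exp (- (V * t\<^sup>2) / 2))"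
      by (intro tendsto_intros V) auto
  qed
  show ?thesis
  proof (cases "V = 0")
    case True
    interpret R: real_distribution "return borel (0::real)"
      by (simp add: real_distribution_def real_distribution_axioms_def prob_space_return)
    have "char (return borel 0) = \<phi>"
      by (intro ext) (simp add: \<phi> True char_def integral_return)
    then have "distr M borel Y = return borel 0"
      unfolding \<phi>_def
      by (intro Levy_uniqueness D.real_distribution_axioms R.real_distribution_axioms) simp
    moreover have "AE x in return borel (0::real). x = 0"
      by (subst AE_return) auto
    ultimately have "AE x in distr M borel Y. x = 0" by (simp only:)
    then have "AE \<omega> in M. Y \<omega> = 0" by (subst (asm) AE_distr_iff) auto
    then show ?thesis by (intro exI[of _ 0]) (auto simp: centred_normal_def)
  next
    case False
    then have "V > 0" using \<open>V \<ge> 0\<close> by simp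
    let ?N = "density lborel (normal_density 0 (sqrt V))"
    interpret R: real_distribution ?N
      using prob_space_normal_density[of "sqrt V" 0] \<open>V > 0\<close>
      by (auto simp: real_distribution_def real_distribution_axioms_def)
    have "char ?N = \<phi>"
      by (intro ext) (use \<open>V > 0\<close> in \<open>simp add: \<phi> char_normal\<close>)
    then have "distr M borel Y = ?N"
      unfolding \<phi>_def
      by (intro Levy_uniqueness D.real_distribution_axioms R.real_distribution_axioms) simp
    moreover have "distr M lborel Y = distr M borel Y" by (rule distr_cong) auto
    ultimately have "distributed M lborel Y (normal_density 0 (sqrt V))"
      by (auto simp: distributed_def)
    then show ?thesis using \<open>V > 0\<close> by (intro exI[of _ V]) (auto simp: centred_normal_def)
  qed
qed

end

locale brownian = prob_space M for M :: "'a measure" +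
  fixes B :: "real \<Rightarrow> 'a \<Rightarrow> real"
  assumes bm: "brownian_motion M B"
begin

lemma B_measurable [measurable]: "0 \<le> t \<Longrightarrow> B t \<in> borel_measurable M"
  using bm by (simp add: brownian_motion_def)

lemma B_0: "AE \<omega> in M. B 0 \<omega> = 0"
  using bm by (simp add: brownian_motion_def)

lemma strict_grid_nonneg:
  fixes \<tau> :: "nat \<Rightarrow> real"
  assumes "0 \<le> \<tau> 0" "\<And>i. i < n \<Longrightarrow> \<tau> i < \<tau> (Suc i)"
  shows "i \<le> n \<Longrightarrow> 0 \<le> \<tau> i"
proof (induction i)
  case (Suc i)
  then show ?case using assms(2)[of i] by auto
qed (use assms in auto)

text \<open>Increments over disjoint intervals are independent normals, so their variances add up. The
terms with coefficient \<open>0\<close> are degenerate and have to be split off first.\<close>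

lemma increment_sum_normal:
  assumes \<tau>: "0 \<le> \<tau> 0" "\<And>i. i < n \<Longrightarrow> \<tau> i < \<tau> (Suc i)"
  shows "centred_normal (\<lambda>\<omega>. \<Sum>i<n. d i * (B (\<tau> (Suc i)) \<omega> - B (\<tau> i) \<omega>))
           (\<Sum>i<n. (d i)\<^sup>2 * (\<tau> (Suc i) - \<tau> i))"
proof -
  define X where "X i \<omega> = B (\<tau> (Suc i)) \<omega> - B (\<tau> i) \<omega>" for i \<omega>
  define I where "I = {i\<in>{..<n}. d i \<noteq> 0}"
  have \<tau>0: "i \<le> n \<Longrightarrow> 0 \<le> \<tau> i" for i by (rule strict_grid_nonneg[OF \<tau>])
  have X[measurable]: "X i \<in> borel_measurable M" if "i < n" for i
    unfolding X_def[abs_def] using that \<tau>0[of i] \<tau>0[of "Suc i"] 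
    by (intro borel_measurable_diff B_measurable) auto
  have sumI: "(\<Sum>i<n. d i * X i \<omega>) = (\<Sum>i\<in>I. d i * X i \<omega>)" for \<omega>
    by (rule sum.mono_neutral_right) (auto simp: I_def)
  have varI: "(\<Sum>i<n. (d i)\<^sup>2 * (\<tau> (Suc i) - \<tau> i)) = (\<Sum>i\<in>I. (\<bar>d i\<bar> * sqrt (\<tau> (Suc i) - \<tau> i))\<^sup>2)"
  proof -
    have "(\<Sum>i<n. (d i)\<^sup>2 * (\<tau> (Suc i) - \<tau> i)) = (\<Sum>i\<in>I. (d i)\<^sup>2 * (\<tau> (Suc i) - \<tau> i))"
      by (rule sum.mono_neutral_right) (auto simp: I_def)
    also have "\<dots> = (\<Sum>i\<in>I. (\<bar>d i\<bar> * sqrt (\<tau> (Suc i) - \<tau> i))\<^sup>2)"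
      by (rule sum.cong) (use \<tau>(2) in \<open>auto simp: I_def power_mult_distrib less_imp_le\<close>)
    finally show ?thesis .
  qed
  show ?thesis
  proof (cases "I = {}")
    case True
    then show ?thesis unfolding varI X_def[symmetric] sumI by (simp add: centred_normal_def)
  next
    case False
    have iv: "indep_vars (\<lambda>_. borel) X {..<n}"
      using bm \<tau> unfolding brownian_motion_def X_def[abs_def] by blast
    have "indep_vars (\<lambda>_. borel) X I"
      by (rule indep_vars_subset[OF iv]) (auto simp: I_def)
    then have iv': "indep_vars (\<lambda>_. borel) (\<lambda>i \<omega>. d i * X i \<omega>) I"
      by (rule indep_vars_compose2) auto
    have dist: "distributed M lborel (\<lambda>\<omega>. d i * X i \<omega>)
        (normal_density 0 (\<bar>d i\<bar> * sqrt (\<tau> (Suc i) - \<tau> i)))" if "i \<in> I" for i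
    proof -
      from that have i: "i < n" "d i \<noteq> 0" by (auto simp: I_def)
      then have "distributed M lborel (X i) (normal_density 0 (sqrt (\<tau> (Suc i) - \<tau> i)))"
        using bm \<tau>(2)[of i] \<tau>0[of i] unfolding brownian_motion_def X_def[abs_def] by auto
      from normal_density_affine[OF this, of "d i" 0] i \<tau>(2)[of i] show ?thesis by simp
    qed
    have "distributed M lborel (\<lambda>\<omega>. \<Sum>i\<in>I. d i * X i \<omega>)
       (normal_density (\<Sum>i\<in>I. 0) (sqrt (\<Sum>i\<in>I. (\<bar>d i\<bar> * sqrt (\<tau> (Suc i) - \<tau> i))\<^sup>2)))"
      by (rule sum_indep_normal[OF _ False iv' _ dist])
         (use \<tau>(2) in \<open>auto simp: I_def\<close>)
    moreover have "(\<Sum>i\<in>I. (\<bar>d i\<bar> * sqrt (\<tau> (Suc i) - \<tau> i))\<^sup>2) > 0"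
      by (rule sum_pos) (use False \<tau>(2) in \<open>force simp: I_def power_mult_distrib\<close>)+
    ultimately show ?thesis unfolding varI X_def[symmetric] sumI
      by (auto simp: centred_normal_def I_def)
  qed
qed

definition brownian_combinations :: "('a \<Rightarrow> real) set" where
  "brownian_combinations = {\<lambda>\<omega>. \<Sum>t\<in>I. d t * B t \<omega> | I d. finite I \<and> I \<subseteq> {0..}}"

text \<open>Abel summation.\<close>

lemma sum_eq_increments:
  fixes b :: "nat \<Rightarrow> real"
  shows "(\<Sum>i\<le>n. d i * b i) = (\<Sum>i\<le>n. d i) * b 0 + (\<Sum>i<n. (\<Sum>j\<in>{Suc i..n}. d j) * (b (Suc i) - b i))"
proof (induction n)
  case (Suc n)
  have "(\<Sum>i<Suc n. (\<Sum>j\<in>{Suc i..Suc n}. d j) * (b (Suc i) - b i)) =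
        (\<Sum>i<Suc n. (\<Sum>j\<in>{Suc i..n}. d j) * (b (Suc i) - b i) + d (Suc n) * (b (Suc i) - b i))"
    by (rule sum.cong) (auto simp: algebra_simps)
  also have "\<dots> = (\<Sum>i<n. (\<Sum>j\<in>{Suc i..n}. d j) * (b (Suc i) - b i)) + d (Suc n) * (b (Suc n) - b 0)"
    unfolding sum.distrib sum_distrib_left[symmetric] sum_lessThan_telescope by simp
  finally show ?case using Suc by (simp add: algebra_simps)
qed simp

text \<open>Adjoining the time \<open>0\<close>, where \<open>B\<close> vanishes almost surely, and sorting the times turns the
combination into one of increments over consecutive intervals.\<close>

lemma brownian_combination_normal:
  assumes "Z \<in> brownian_combinations"
  shows "\<exists>v. centred_normal Z v"
proof -
  obtain I d where I: "finite I" "I \<subseteq> {0..}" and Z: "Z = (\<lambda>\<omega>. \<Sum>t\<in>I. d t * B t \<omega>)"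
    using assms by (auto simp: brownian_combinations_def)
  define xs where "xs = sorted_list_of_set (insert 0 I)"
  define n where "n = card (insert 0 I) - 1"
  have len: "length xs = Suc n"
  proof -
    have "card (insert 0 I) > 0" using I by (subst card_gt_0_iff) auto
    then show ?thesis unfolding xs_def n_def by simp
  qed
  have set: "set xs = insert 0 I" unfolding xs_def using I by (intro set_sorted_list_of_set) auto
  have sw: "sorted_wrt (<) xs" by (simp add: xs_def)
  define \<tau> where "\<tau> i = xs ! i" for i
  have mono: "\<tau> i < \<tau> (Suc i)" if "i < n" for i
    using sorted_wrt_nth_less[OF sw, of i "Suc i"] that by (simp add: \<tau>_def len)
  have "\<tau> 0 = 0"
  proof -
    have "\<tau> 0 \<ge> 0" using nth_mem[of 0 xs] len I unfolding set by (auto simp: \<tau>_def)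
    moreover obtain j where "j < length xs" "xs ! j = 0"
      using set by (metis in_set_conv_nth insertI1)
    moreover have "\<tau> 0 \<le> xs ! j" using sorted_wrt_nth_less[OF sw, of 0 j] \<open>j < length xs\<close>
      by (cases "j = 0") (auto simp: \<tau>_def)
    ultimately show ?thesis by simp
  qed
  have bij: "bij_betw \<tau> {..n} (insert 0 I)"
  proof -
    have "bij_betw ((!) xs) {..<length xs} (set xs)"
      by (rule bij_betw_nth) (use sw in \<open>auto simp: xs_def\<close>)
    then show ?thesis unfolding set len lessThan_Suc_atMost \<tau>_def[abs_def] .
  qed
  \<comment> \<open>The time \<open>0\<close> need not belong to \<open>I\<close> and then gets the coefficient \<open>0\<close>.\<close>
  define e where "e t = (if t \<in> I then d t else 0)" for t
  define D where "D i = (\<Sum>j\<in>{Suc i..n}. e (\<tau> j))" for i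
  have "centred_normal (\<lambda>\<omega>. \<Sum>i<n. D i * (B (\<tau> (Suc i)) \<omega> - B (\<tau> i) \<omega>))
           (\<Sum>i<n. (D i)\<^sup>2 * (\<tau> (Suc i) - \<tau> i))"
    by (rule increment_sum_normal) (use \<open>\<tau> 0 = 0\<close> mono in auto)
  moreover have "AE \<omega> in M. (\<Sum>i<n. D i * (B (\<tau> (Suc i)) \<omega> - B (\<tau> i) \<omega>)) = Z \<omega>"
    using B_0
  proof eventually_elim
    case (elim \<omega>)
    have "Z \<omega> = (\<Sum>t\<in>insert 0 I. e t * B t \<omega>)"
      unfolding Z by (rule sum.mono_neutral_cong_left) (use I in \<open>auto simp: e_def\<close>)
    also have "\<dots> = (\<Sum>i\<le>n. e (\<tau> i) * B (\<tau> i) \<omega>)"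
      by (rule sum.reindex_bij_betw[OF bij, symmetric])
    also have "\<dots> = (\<Sum>i<n. D i * (B (\<tau> (Suc i)) \<omega> - B (\<tau> i) \<omega>))"
      by (subst sum_eq_increments) (simp add: \<open>\<tau> 0 = 0\<close> elim D_def)
    finally show ?case by simp
  qed
  moreover have "Z \<in> borel_measurable M" unfolding Z using I by (intro borel_measurable_sum borel_measurable_times B_measurable) auto
  ultimately show ?thesis using centred_normal_AE_cong by blast
qed

text \<open>The first Wiener chaos, described through almost sure limits of sequences. It is a vector space
of Gaussian variables containing all the Wiener integrals below; this is what makes the solution a
Gaussian process and not merely Gaussian at each time.\<close>

definition first_chaos :: "('a \<Rightarrow> real) set" where
  "first_chaos = {Z \<in> borel_measurable M.
     \<exists>S. (\<forall>k::nat. S k \<in> brownian_combinations) \<and> (AE \<omega> in M. (\<lambda>k. S k \<omega>) \<longlonglongrightarrow> Z \<omega>)}"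

lemma first_chaos_gaussian: "Z \<in> first_chaos \<Longrightarrow> gaussian_rv M Z"
proof -
  assume "Z \<in> first_chaos"
  then obtain S where S: "\<And>k::nat. S k \<in> brownian_combinations"
    "AE \<omega> in M. (\<lambda>k. S k \<omega>) \<longlonglongrightarrow> Z \<omega>" "Z \<in> borel_measurable M"
    by (auto simp: first_chaos_def)
  from brownian_combination_normal[OF S(1)] obtain v where "\<And>k. centred_normal (S k) (v k)"
    by metis
  from centred_normal_limit[OF this S(2,3)] show ?thesis
    using centred_normal_imp_gaussian_rv by blast
qed

lemma brownian_combinations_linear:
  assumes "Y \<in> brownian_combinations" "Z \<in> brownian_combinations"
  shows "(\<lambda>\<omega>. Y \<omega> + r * Z \<omega>) \<in> brownian_combinations"
proof -
  obtain I d where I: "finite I" "I \<subseteq> {0..}" and Y: "Y = (\<lambda>\<omega>. \<Sum>t\<in>I. d t * B t \<omega>)"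
    using assms by (auto simp: brownian_combinations_def)
  obtain J e where J: "finite J" "J \<subseteq> {0..}" and Z: "Z = (\<lambda>\<omega>. \<Sum>t\<in>J. e t * B t \<omega>)"
    using assms by (auto simp: brownian_combinations_def)
  define h where "h t = (if t \<in> I then d t else 0) + r * (if t \<in> J then e t else 0)" for t
  have "Y \<omega> + r * Z \<omega> = (\<Sum>t\<in>I \<union> J. h t * B t \<omega>)" for \<omega>
  proof -
    have "Y \<omega> = (\<Sum>t\<in>I \<union> J. (if t \<in> I then d t else 0) * B t \<omega>)"
      unfolding Y by (rule sum.mono_neutral_cong_left) (use I J in auto)
    moreover have "Z \<omega> = (\<Sum>t\<in>I \<union> J. (if t \<in> J then e t else 0) * B t \<omega>)"
      unfolding Z by (rule sum.mono_neutral_cong_left) (use I J in auto)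
    ultimately show ?thesis
      by (simp add: h_def sum_distrib_left sum.distrib distrib_right mult.assoc)
  qed
  then have "(\<lambda>\<omega>. Y \<omega> + r * Z \<omega>) = (\<lambda>\<omega>. \<Sum>t\<in>I \<union> J. h t * B t \<omega>)" by auto
  then show ?thesis unfolding brownian_combinations_def using I J
    by (intro CollectI exI[of _ "I \<union> J"] exI[of _ h]) auto
qed

lemma zero_brownian_combination: "(\<lambda>\<omega>. 0) \<in> brownian_combinations"
  unfolding brownian_combinations_def by (intro CollectI exI[of _ "{}"]) auto

lemma B_brownian_combination: "0 \<le> t \<Longrightarrow> B t \<in> brownian_combinations"
  unfolding brownian_combinations_def by (intro CollectI exI[of _ "{t}"] exI[of _ "\<lambda>_. 1"]) auto

lemma first_chaos_linear:
  assumes "Y \<in> first_chaos" "Z \<in> first_chaos"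
  shows "(\<lambda>\<omega>. Y \<omega> + r * Z \<omega>) \<in> first_chaos"
proof -
  obtain S where S: "\<And>k::nat. S k \<in> brownian_combinations"
    "AE \<omega> in M. (\<lambda>k. S k \<omega>) \<longlonglongrightarrow> Y \<omega>" and [measurable]: "Y \<in> borel_measurable M"
    using assms by (auto simp: first_chaos_def)
  obtain R where R: "\<And>k::nat. R k \<in> brownian_combinations"
    "AE \<omega> in M. (\<lambda>k. R k \<omega>) \<longlonglongrightarrow> Z \<omega>" and [measurable]: "Z \<in> borel_measurable M"
    using assms by (auto simp: first_chaos_def)
  have "AE \<omega> in M. (\<lambda>k. S k \<omega> + r * R k \<omega>) \<longlonglongrightarrow> Y \<omega> + r * Z \<omega>"
    using S(2) R(2) by eventually_elim (intro tendsto_intros)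
  moreover have "(\<lambda>\<omega>. S k \<omega> + r * R k \<omega>) \<in> brownian_combinations" for k
    by (rule brownian_combinations_linear[OF S(1) R(1)])
  ultimately show ?thesis unfolding first_chaos_def
    by (intro CollectI conjI exI[of _ "\<lambda>k \<omega>. S k \<omega> + r * R k \<omega>"]) auto
qed

lemma first_chaos_sum:
  assumes "finite I" "\<And>t. t \<in> I \<Longrightarrow> Z t \<in> first_chaos"
  shows "(\<lambda>\<omega>. \<Sum>t\<in>I. d t * Z t \<omega>) \<in> first_chaos"
  using assms
proof (induction I)
  case empty
  then show ?case unfolding first_chaos_def
    by (auto intro!: exI[of _ "\<lambda>_ _. 0"] zero_brownian_combination)
next
  case (insert t I)
  then have "(\<lambda>\<omega>. (\<Sum>t\<in>I. d t * Z t \<omega>) + d t * Z t \<omega>) \<in> first_chaos"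
    by (intro first_chaos_linear) auto
  then show ?case using insert by (simp add: add.commute)
qed

end

section \<open>The Wiener integral of a continuously differentiable function\<close>

definition grid :: "real \<Rightarrow> nat \<Rightarrow> nat \<Rightarrow> real" where
  "grid T n i = T * real i / real n"

definition riemann_ito :: "(real \<Rightarrow> real) \<Rightarrow> (real \<Rightarrow> real) \<Rightarrow> real \<Rightarrow> nat \<Rightarrow> real" where
  "riemann_ito f b T n = (\<Sum>i<n. f (grid T n i) * (b (grid T n (Suc i)) - b (grid T n i)))"

lemma grid_0 [simp]: "grid T n 0 = 0"
  by (simp add: grid_def)

lemma grid_self [simp]: "0 < n \<Longrightarrow> grid T n n = T"
  by (simp add: grid_def)

lemma grid_step: "grid T n (Suc i) - grid T n i = T / real n"
  by (simp add: grid_def distrib_left add_divide_distrib)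

lemma grid_in: "0 \<le> T \<Longrightarrow> i \<le> n \<Longrightarrow> grid T n i \<in> {0..T}"
  by (cases "n = 0") (auto simp: grid_def divide_le_eq mult_left_mono)

lemma grid_mono: "0 \<le> T \<Longrightarrow> grid T n i \<le> grid T n (Suc i)"
  by (simp add: grid_def divide_right_mono mult_left_mono)

text \<open>The difference equals \<open>\<integral> f' r * (b t - b r) dr\<close>, and this is small when \<open>b\<close> oscillates little on
\<open>[s, t]\<close>.\<close>

lemma integration_by_parts_step:
  fixes f f' b :: "real \<Rightarrow> real"
  assumes st: "s \<le> t"
    and f: "\<And>r. r \<in> {s..t} \<Longrightarrow> (f has_real_derivative f' r) (at r)"
    and f': "continuous_on {s..t} f'" and b: "continuous_on {s..t} b"
    and C: "\<And>r. r \<in> {s..t} \<Longrightarrow> \<bar>f' r\<bar> \<le> C" and e: "\<And>r. r \<in> {s..t} \<Longrightarrow> \<bar>b t - b r\<bar> \<le> e"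
  shows "\<bar>f t * b t - f s * b s - integral {s..t} (\<lambda>r. f' r * b r) - f s * (b t - b s)\<bar> \<le> C * e * (t - s)"
proof -
  have "(f' has_integral f t - f s) {s..t}"
    by (rule fundamental_theorem_of_calculus[OF st])
       (use f in \<open>auto simp: has_real_derivative_iff_has_vector_derivative[symmetric]
          intro: has_field_derivative_at_within\<close>)
  then have "((\<lambda>r. f' r * b t) has_integral (f t - f s) * b t) {s..t}"
    by (rule has_integral_mult_left)
  moreover have "((\<lambda>r. f' r * b r) has_integral integral {s..t} (\<lambda>r. f' r * b r)) {s..t}"
    by (intro integrable_integral integrable_continuous_real continuous_intros f' b)
  ultimately have "((\<lambda>r. f' r * b t - f' r * b r) has_integral
      (f t - f s) * b t - integral {s..t} (\<lambda>r. f' r * b r)) {s..t}"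
    by (rule has_integral_diff)
  then have "integral {s..t} (\<lambda>r. f' r * b t - f' r * b r) =
      (f t - f s) * b t - integral {s..t} (\<lambda>r. f' r * b r)"
    by (rule integral_unique)
  moreover have "norm (integral {s..t} (\<lambda>r. f' r * b t - f' r * b r)) \<le> C * e * (t - s)"
  proof (rule integral_bound[OF st])
    show "continuous_on {s..t} (\<lambda>r. f' r * b t - f' r * b r)"
      by (intro continuous_intros f' b)
    show "\<And>r. r \<in> {s..t} \<Longrightarrow> norm (f' r * b t - f' r * b r) \<le> C * e"
      using C e unfolding right_diff_distrib[symmetric] real_norm_def abs_mult
      by (intro mult_mono') auto
  qed
  ultimately show ?thesis by (simp add: algebra_simps)
qed

text \<open>Although \<open>b\<close> may have infinite variation, the smoothness of \<open>f\<close> lets the sums converge for each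
single path: the limit telescopes over the grid, and uniform continuity of \<open>b\<close> bounds the errors of
the individual steps by \<open>C * e\<close> times the step length.\<close>

lemma riemann_ito_tendsto:
  fixes f f' b :: "real \<Rightarrow> real"
  assumes T: "0 \<le> T"
    and f: "\<And>r. (f has_real_derivative f' r) (at r)"
    and f': "continuous_on UNIV f'" and b: "continuous_on {0..T} b" and b0: "b 0 = 0"
  shows "riemann_ito f b T \<longlonglongrightarrow> f T * b T - integral {0..T} (\<lambda>r. f' r * b r)"
proof -
  have f'T: "continuous_on {0..T} f'" using f' continuous_on_subset by blast
  obtain C where C: "C > 0" "\<And>r. r \<in> {0..T} \<Longrightarrow> \<bar>f' r\<bar> \<le> C"
    using compact_imp_bounded[OF compact_continuous_image[OF f'T compact_Icc]]
    unfolding bounded_pos by auto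
  define \<phi> where "\<phi> t = f t * b t - integral {0..t} (\<lambda>r. f' r * b r)" for t
  have unif: "uniformly_continuous_on {0..T} b" by (rule compact_uniformly_continuous[OF b compact_Icc])
  show ?thesis unfolding \<phi>_def[symmetric]
  proof (rule LIMSEQ_I)
    fix r :: real assume "0 < r"
    \<comment> \<open>The summand \<open>1\<close> covers \<open>T = 0\<close>.\<close>
    define e where "e = r / (2 * (C * T + 1))"
    have CT: "C * T + 1 > 0" using C T by (simp add: add_nonneg_pos)
    have "e > 0" using \<open>0 < r\<close> CT by (simp add: e_def)
    obtain d where d: "d > 0" "\<And>x x'. x \<in> {0..T} \<Longrightarrow> x' \<in> {0..T} \<Longrightarrow> dist x' x < d \<Longrightarrow> dist (b x') (b x) < e"
      using unif \<open>e > 0\<close> unfolding uniformly_continuous_on_def by metis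
    obtain n0 :: nat where n0: "T / d < real n0" using reals_Archimedean2 by blast
    show "\<exists>no. \<forall>n\<ge>no. norm (riemann_ito f b T n - \<phi> T) < r"
    proof (intro exI[of _ "Suc n0"] allI impI)
      fix n assume n: "Suc n0 \<le> n"
      then have n1: "n > 0" "T / d < real n" using n0 by auto
      then have step: "T / real n < d" using d(1) by (simp add: field_simps)
      have "norm (\<phi> (grid T n (Suc i)) - \<phi> (grid T n i) - f (grid T n i) * (b (grid T n (Suc i)) - b (grid T n i)))
          \<le> C * e * (T / real n)" if "i < n" for i
      proof -
        let ?s = "grid T n i" and ?t = "grid T n (Suc i)"
        have s: "?s \<in> {0..T}" and t: "?t \<in> {0..T}" and st: "?s \<le> ?t"
          using that T by (auto simp only: grid_mono intro!: grid_in)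
        have sub: "{?s..?t} \<subseteq> {0..T}" using s t by auto
        have "integral {0..?t} (\<lambda>r. f' r * b r) = integral {0..?s} (\<lambda>r. f' r * b r) + integral {?s..?t} (\<lambda>r. f' r * b r)"
          by (rule Henstock_Kurzweil_Integration.integral_combine[symmetric])
             (use s t st in \<open>auto intro!: integrable_continuous_real continuous_intros
                continuous_on_subset[OF f'T] continuous_on_subset[OF b]\<close>)
        then have "\<phi> ?t - \<phi> ?s = f ?t * b ?t - f ?s * b ?s - integral {?s..?t} (\<lambda>r. f' r * b r)"
          by (simp add: \<phi>_def)
        moreover have "\<bar>f ?t * b ?t - f ?s * b ?s - integral {?s..?t} (\<lambda>r. f' r * b r) - f ?s * (b ?t - b ?s)\<bar>
            \<le> C * e * (?t - ?s)"
        proof (rule integration_by_parts_step[OF st f])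
          show "continuous_on {?s..?t} f'" "continuous_on {?s..?t} b"
            using f'T b continuous_on_subset[OF _ sub] by blast+
          show "\<bar>f' r\<bar> \<le> C" if "r \<in> {?s..?t}" for r using C(2) sub that by blast
          show "\<bar>b ?t - b r\<bar> \<le> e" if r: "r \<in> {?s..?t}" for r
          proof -
            have "dist ?t r < d" using r step grid_step[of T n i] by (auto simp: dist_real_def)
            then have "dist (b ?t) (b r) < e" using d(2)[of r ?t] t r sub by blast
            then show ?thesis by (simp add: dist_real_def)
          qed
        qed
        ultimately show ?thesis by (simp add: grid_step)
      qed
      then have "(\<Sum>i<n. norm (\<phi> (grid T n (Suc i)) - \<phi> (grid T n i) - f (grid T n i) * (b (grid T n (Suc i)) - b (grid T n i))))
         \<le> (\<Sum>i<n. C * e * (T / real n))"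
        by (intro sum_mono) auto
      also have "\<dots> = C * e * T" using n1 by simp
      finally have "norm (\<Sum>i<n. \<phi> (grid T n (Suc i)) - \<phi> (grid T n i) - f (grid T n i) * (b (grid T n (Suc i)) - b (grid T n i))) \<le> C * e * T"
        by (rule order_trans[OF norm_sum])
      moreover have "(\<Sum>i<n. \<phi> (grid T n (Suc i)) - \<phi> (grid T n i) - f (grid T n i) * (b (grid T n (Suc i)) - b (grid T n i)))
         = \<phi> T - riemann_ito f b T n"
        using sum_lessThan_telescope[of "\<lambda>i. \<phi> (grid T n i)" n] n1
        unfolding sum_subtractf riemann_ito_def by (simp add: \<phi>_def b0)
      ultimately have "\<bar>\<phi> T - riemann_ito f b T n\<bar> \<le> (C * T) * e" by (simp add: mult_ac)
      also have "\<dots> < r"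
      proof -
        have "(C * T) * e \<le> (C * T + 1) * e" using \<open>e > 0\<close> by simp
        also have "\<dots> = r / 2"
        proof -
          have "K * (r / (2 * K)) = r / 2" if "K > 0" for K :: real using that by simp
          from this[OF CT] show ?thesis unfolding e_def .
        qed
        finally show ?thesis using \<open>0 < r\<close> by simp
      qed
      finally show "norm (riemann_ito f b T n - \<phi> T) < r" by (simp add: abs_minus_commute)
    qed
  qed
qed

text \<open>On the subgrid with \<open>n * m\<close> steps the sum with \<open>n\<close> steps has an integrand that is constant on
blocks of length \<open>m\<close>, which makes it comparable with the sum of \<open>f\<close> on the subgrid.\<close>

lemma riemann_ito_refine:
  assumes "0 < n" "0 < m"
  shows "riemann_ito f b T n =
    (\<Sum>j<n * m. f (grid T n (j div m)) * (b (grid T (n * m) (Suc j)) - b (grid T (n * m) j)))"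
proof -
  have g: "grid T (n * m) (i * m) = grid T n i" for i
    using assms by (simp add: grid_def)
  have "(\<Sum>j<n * m. f (grid T n (j div m)) * (b (grid T (n * m) (Suc j)) - b (grid T (n * m) j)))
    = (\<Sum>i<n. \<Sum>j\<in>{i * m..<i * m + m}. f (grid T n (j div m)) * (b (grid T (n * m) (Suc j)) - b (grid T (n * m) j)))"
    by (rule sum.nat_group[symmetric])
  also have "\<dots> = (\<Sum>i<n. f (grid T n i) * (b (grid T n (Suc i)) - b (grid T n i)))"
  proof (rule sum.cong)
    fix i
    have "(\<Sum>j\<in>{i * m..<i * m + m}. f (grid T n (j div m)) * (b (grid T (n * m) (Suc j)) - b (grid T (n * m) j)))
      = (\<Sum>j\<in>{i * m..<i * m + m}. f (grid T n i) * (b (grid T (n * m) (Suc j)) - b (grid T (n * m) j)))"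
    proof (rule sum.cong)
      fix j assume "j \<in> {i * m..<i * m + m}"
      then have "j div m = i" by (intro div_nat_eqI) (auto simp: mult.commute)
      then show "f (grid T n (j div m)) * (b (grid T (n * m) (Suc j)) - b (grid T (n * m) j))
        = f (grid T n i) * (b (grid T (n * m) (Suc j)) - b (grid T (n * m) j))" by simp
    qed simp
    also have "\<dots> = f (grid T n i) * (b (grid T (n * m) (i * m + m)) - b (grid T (n * m) (i * m)))"
      unfolding sum_distrib_left[symmetric]
      by (subst sum_Suc_diff'[where f="\<lambda>j. b (grid T (n * m) j)"]) auto
    also have "\<dots> = f (grid T n i) * (b (grid T (n * m) (Suc i * m)) - b (grid T (n * m) (i * m)))"
      by (simp add: add.commute)
    finally have "(\<Sum>j\<in>{i * m..<i * m + m}. f (grid T n (j div m)) * (b (grid T (n * m) (Suc j)) - b (grid T (n * m) j)))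
      = f (grid T n i) * (b (grid T (n * m) (Suc i * m)) - b (grid T (n * m) (i * m)))" .
    then show "(\<Sum>j\<in>{i * m..<i * m + m}. f (grid T n (j div m)) * (b (grid T (n * m) (Suc j)) - b (grid T (n * m) j)))
      = f (grid T n i) * (b (grid T n (Suc i)) - b (grid T n i))" by (simp only: g)
  qed simp
  finally show ?thesis by (simp add: riemann_ito_def)
qed

lemma at_within_Ici_eq_Icc: "x < T \<Longrightarrow> at x within {a..} = at x within {a..T::real}"
  by (rule at_within_nhd[of _ "{..<T}"]) auto

lemma continuous_on_Ici_real:
  fixes g :: "real \<Rightarrow> real"
  assumes "\<And>T. continuous_on {a..T} g"
  shows "continuous_on {a..} g"
  unfolding continuous_on_eq_continuous_within
proof
  fix x assume "x \<in> {a..}"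
  then have "continuous (at x within {a..x + 1}) g"
    using assms[of "x + 1"] by (auto simp: continuous_on_eq_continuous_within)
  then show "continuous (at x within {a..}) g"
    using at_within_Ici_eq_Icc[of x "x + 1" a] by simp
qed

context brownian begin

abbreviation "F \<equiv> brownian_filtration M B"

lemma generators_F:
  "0 \<le> t \<Longrightarrow> (\<Union>s\<in>{0..t}. {B s -` A \<inter> space M | A. A \<in> sets borel}) \<union> null_sets M \<subseteq> sets M"
  by (auto intro!: measurable_sets[OF B_measurable])

lemma space_F [simp]: "space (F t) = space M"
  by (simp add: brownian_filtration_def space_measure_of_conv)

lemma sets_F: "0 \<le> t \<Longrightarrow> sets (F t) = sigma_sets (space M)
       ((\<Union>s\<in>{0..t}. {B s -` A \<inter> space M | A. A \<in> sets borel}) \<union> null_sets M)"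
  unfolding brownian_filtration_def
  using generators_F[of t] sets.sets_into_space by (intro sets_measure_of) blast

lemma sets_F_subset: "0 \<le> t \<Longrightarrow> sets (F t) \<subseteq> sets M"
  unfolding sets_F using generators_F by (intro sets.sigma_sets_subset)

lemma measurable_F_imp: "0 \<le> t \<Longrightarrow> Z \<in> borel_measurable (F t) \<Longrightarrow> Z \<in> borel_measurable M"
  using measurable_mono[of borel borel "F t" M] sets_F_subset[of t] by auto

lemma sets_F_mono: "0 \<le> s \<Longrightarrow> s \<le> t \<Longrightarrow> sets (F s) \<subseteq> sets (F t)"
  using sets_F[of s] sets_F[of t] by (simp only:) (intro sigma_sets_mono', fastforce)

lemma measurable_F_mono:
  "0 \<le> s \<Longrightarrow> s \<le> t \<Longrightarrow> Z \<in> borel_measurable (F s) \<Longrightarrow> Z \<in> borel_measurable (F t)"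
  using measurable_mono[of borel borel "F s" "F t"] sets_F_mono[of s t] by auto

lemma null_sets_F: "0 \<le> t \<Longrightarrow> N \<in> null_sets M \<Longrightarrow> N \<in> sets (F t)"
  unfolding sets_F by (auto intro: sigma_sets.Basic)

lemma B_adapted: "0 \<le> t \<Longrightarrow> B t \<in> borel_measurable (F t)"
  by (rule measurableI) (auto simp: sets_F intro!: sigma_sets.Basic UnI1 UN_I[of t])

lemma exists_regular_null_set:
  "\<exists>N. N \<in> null_sets M \<and> (\<forall>\<omega>\<in>space M - N. continuous_on {0..} (\<lambda>t. B t \<omega>) \<and> B 0 \<omega> = 0)"
proof -
  have "AE \<omega> in M. continuous_on {0..} (\<lambda>t. B t \<omega>) \<and> B 0 \<omega> = 0"
    using bm by (auto simp: brownian_motion_def continuous_process_def)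
  then show ?thesis by (elim AE_E) (auto simp: null_sets_def)
qed

text \<open>One fixed null set outside of which the path is continuous and starts at \<open>0\<close>. Since null sets
belong to every \<open>F t\<close>, replacing the path there by \<open>0\<close> gives an adapted version \<open>W\<close> of \<open>B\<close> all of
whose paths are regular, and pathwise constructions need no exceptional set.\<close>

definition irregular :: "'a set" where
  "irregular = (SOME N. N \<in> null_sets M \<and>
     (\<forall>\<omega>\<in>space M - N. continuous_on {0..} (\<lambda>t. B t \<omega>) \<and> B 0 \<omega> = 0))"

lemma irregular: "irregular \<in> null_sets M"
  "\<omega> \<in> space M \<Longrightarrow> \<omega> \<notin> irregular \<Longrightarrow> continuous_on {0..} (\<lambda>t. B t \<omega>) \<and> B 0 \<omega> = 0"
  using someI_ex[OF exists_regular_null_set] unfolding irregular_def[symmetric] by auto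

definition W :: "real \<Rightarrow> 'a \<Rightarrow> real" where
  "W t \<omega> = (if \<omega> \<in> irregular then 0 else B t \<omega>)"

lemma W_continuous: "\<omega> \<in> space M \<Longrightarrow> continuous_on {0..} (\<lambda>t. W t \<omega>)"
  using irregular(2) by (cases "\<omega> \<in> irregular") (auto simp: W_def)

lemma W_continuous_Icc: "\<omega> \<in> space M \<Longrightarrow> 0 \<le> s \<Longrightarrow> continuous_on {s..t} (\<lambda>t. W t \<omega>)"
  by (rule continuous_on_subset[OF W_continuous]) auto

lemma W_0: "\<omega> \<in> space M \<Longrightarrow> W 0 \<omega> = 0"
  using irregular(2) by (auto simp: W_def)

lemma W_eq_B: "AE \<omega> in M. \<forall>t. W t \<omega> = B t \<omega>"
  by (rule AE_I'[OF irregular(1)]) (auto simp: W_def)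

lemma W_adapted: "0 \<le> t \<Longrightarrow> W t \<in> borel_measurable (F t)"
  unfolding W_def[abs_def]
  using null_sets_F[OF _ irregular(1), of t] irregular(1)
  by (intro measurable_If_set B_adapted) (auto intro!: sets.Int_space_eq2[THEN ssubst])

text \<open>The integral \<open>\<integral>\<^sub>0\<^sup>t f dB\<close> defined by integration by parts, with \<open>f'\<close> the derivative of \<open>f\<close>. The formula
makes sense for each path and yields the continuous adapted version at once.\<close>

definition wiener :: "(real \<Rightarrow> real) \<Rightarrow> (real \<Rightarrow> real) \<Rightarrow> real \<Rightarrow> 'a \<Rightarrow> real" where
  "wiener f f' t \<omega> = f t * W t \<omega> - integral {0..t} (\<lambda>s. f' s * W s \<omega>)"

context
  fixes f f' :: "real \<Rightarrow> real"
  assumes f: "\<And>t. (f has_real_derivative f' t) (at t)"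
    and f': "continuous_on UNIV f'"
begin

lemma riemann_tendsto_wiener:
  "0 \<le> T \<Longrightarrow> \<omega> \<in> space M \<Longrightarrow> riemann_ito f (\<lambda>t. W t \<omega>) T \<longlonglongrightarrow> wiener f f' T \<omega>"
  unfolding wiener_def by (intro riemann_ito_tendsto f f' W_continuous_Icc W_0) auto

lemma riemann_measurable_F:
  assumes "0 \<le> T"
  shows "(\<lambda>\<omega>. riemann_ito f (\<lambda>t. W t \<omega>) T n) \<in> borel_measurable (F T)"
  unfolding riemann_ito_def
proof (intro borel_measurable_sum borel_measurable_times borel_measurable_const borel_measurable_diff)
  fix i assume "i \<in> {..<n}"
  then have "grid T n i \<in> {0..T}" "grid T n (Suc i) \<in> {0..T}"
    using assms by (intro grid_in; simp)+
  then show "W (grid T n (Suc i)) \<in> borel_measurable (F T)" "W (grid T n i) \<in> borel_measurable (F T)"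
    by (auto intro: measurable_F_mono W_adapted)
qed

lemma wiener_adapted: "0 \<le> T \<Longrightarrow> wiener f f' T \<in> borel_measurable (F T)"
  by (rule borel_measurable_LIMSEQ_real[OF _ riemann_measurable_F])
     (auto intro: riemann_tendsto_wiener)

lemma wiener_measurable: "0 \<le> T \<Longrightarrow> wiener f f' T \<in> borel_measurable M"
  using wiener_adapted measurable_F_imp by blast

lemma wiener_first_chaos:
  assumes "0 \<le> T"
  shows "wiener f f' T \<in> first_chaos"
proof -
  have "AE \<omega> in M. (\<lambda>k. riemann_ito f (\<lambda>t. B t \<omega>) T k) \<longlonglongrightarrow> wiener f f' T \<omega>"
    using W_eq_B AE_space
  proof eventually_elim
    case (elim \<omega>)
    then show ?case using riemann_tendsto_wiener[OF assms, of \<omega>] by simp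
  qed
  moreover have "(\<lambda>\<omega>. riemann_ito f (\<lambda>t. B t \<omega>) T k) \<in> brownian_combinations" for k
  proof -
    have "(\<lambda>\<omega>. \<Sum>i<n. f (grid T k i) * (B (grid T k (Suc i)) \<omega> - B (grid T k i) \<omega>)) \<in> brownian_combinations"
      if "n \<le> k" for n
      using that
    proof (induction n)
      case 0
      then show ?case by (simp add: zero_brownian_combination)
    next
      case (Suc n)
      then have g: "0 \<le> grid T k n" "0 \<le> grid T k (Suc n)"
        using assms grid_in[of T n k] grid_in[of T "Suc n" k] by auto
      have "(\<lambda>\<omega>. ((\<Sum>i<n. f (grid T k i) * (B (grid T k (Suc i)) \<omega> - B (grid T k i) \<omega>))
          + f (grid T k n) * B (grid T k (Suc n)) \<omega>) + (- f (grid T k n)) * B (grid T k n) \<omega>) \<in> brownian_combinations"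
        using Suc g by (intro brownian_combinations_linear B_brownian_combination) auto
      then show ?case by (simp add: algebra_simps)
    qed
    then show ?thesis by (simp add: riemann_ito_def)
  qed
  ultimately show ?thesis using wiener_measurable[OF assms]
    by (auto simp: first_chaos_def intro!: exI[of _ "\<lambda>k \<omega>. riemann_ito f (\<lambda>t. B t \<omega>) T k"])
qed

lemma wiener_continuous: "\<omega> \<in> space M \<Longrightarrow> continuous_on {0..} (\<lambda>t. wiener f f' t \<omega>)"
proof -
  assume \<omega>: "\<omega> \<in> space M"
  have "continuous_on {0..T} (\<lambda>t. integral {0..t} (\<lambda>s. f' s * W s \<omega>))" for T
    by (intro indefinite_integral_continuous_1 integrable_continuous_real continuous_intros
        continuous_on_subset[OF f'] W_continuous_Icc \<omega>) auto
  then have "continuous_on {0..} (\<lambda>t. integral {0..t} (\<lambda>s. f' s * W s \<omega>))"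
    by (rule continuous_on_Ici_real)
  moreover have "continuous_on {0..} f"
    using f by (intro continuous_at_imp_continuous_on) (auto intro: DERIV_isCont)
  ultimately show ?thesis unfolding wiener_def
    by (intro continuous_intros W_continuous \<omega>)
qed

text \<open>The difference of the two sums is a combination of increments on the finer grid whose
coefficients are differences of \<open>f\<close> over a distance of at most \<open>T / n\<close>. The bound does not depend on
\<open>m\<close>.\<close>

lemma riemann_refinement_second_moment:
  assumes T: "0 < T" and nm: "0 < n" "0 < m"
    and L: "\<And>x y. x \<in> {0..T} \<Longrightarrow> y \<in> {0..T} \<Longrightarrow> \<bar>f x - f y\<bar> \<le> L * \<bar>x - y\<bar>" and L0: "0 \<le> L"
  shows "(\<integral>\<^sup>+\<omega>. ennreal ((riemann_ito f (\<lambda>t. W t \<omega>) T (n * m) - riemann_ito f (\<lambda>t. W t \<omega>) T n)\<^sup>2) \<partial>M)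
    \<le> ennreal ((L * T / real n)\<^sup>2 * T)"
proof -
  let ?g = "grid T (n * m)"
  define d where "d j = f (?g j) - f (grid T n (j div m))" for j
  have d: "\<bar>d j\<bar> \<le> L * T / real n" if "j < n * m" for j
  proof -
    have j: "j div m \<le> n" using that nm by (simp add: less_mult_imp_div_less less_imp_le)
    have "real j = real m * real (j div m) + real (j mod m)"
      by (metis mult_div_mod_eq of_nat_add of_nat_mult)
    then have "?g j - grid T n (j div m) = T * real (j mod m) / (real n * real m)"
      using nm by (simp add: grid_def field_simps)
    moreover have "T * real (j mod m) / (real n * real m) \<le> T * real m / (real n * real m)"
      using nm T by (intro divide_right_mono mult_left_mono) (auto simp: less_imp_le)
    ultimately have "\<bar>?g j - grid T n (j div m)\<bar> \<le> T / real n"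
      using nm T by simp
    then have "L * \<bar>?g j - grid T n (j div m)\<bar> \<le> L * (T / real n)"
      using L0 by (rule mult_left_mono)
    moreover have "?g j \<in> {0..T}" "grid T n (j div m) \<in> {0..T}"
      using that T j by (auto simp del: atLeastAtMost_iff intro!: grid_in)
    ultimately show ?thesis using L[of "?g j" "grid T n (j div m)"] by (simp add: d_def)
  qed
  have cn: "centred_normal (\<lambda>\<omega>. \<Sum>j<n * m. d j * (B (?g (Suc j)) \<omega> - B (?g j) \<omega>))
      (\<Sum>j<n * m. (d j)\<^sup>2 * (?g (Suc j) - ?g j))"
    by (rule increment_sum_normal) (use T nm in \<open>auto simp: grid_def divide_strict_right_mono\<close>)
  have "(\<integral>\<^sup>+\<omega>. ennreal ((riemann_ito f (\<lambda>t. W t \<omega>) T (n * m) - riemann_ito f (\<lambda>t. W t \<omega>) T n)\<^sup>2) \<partial>M)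
      = (\<integral>\<^sup>+\<omega>. ennreal ((\<Sum>j<n * m. d j * (B (?g (Suc j)) \<omega> - B (?g j) \<omega>))\<^sup>2) \<partial>M)"
  proof (rule nn_integral_cong_AE)
    show "AE \<omega> in M. ennreal ((riemann_ito f (\<lambda>t. W t \<omega>) T (n * m) - riemann_ito f (\<lambda>t. W t \<omega>) T n)\<^sup>2)
       = ennreal ((\<Sum>j<n * m. d j * (B (?g (Suc j)) \<omega> - B (?g j) \<omega>))\<^sup>2)"
      using W_eq_B
      by eventually_elim
         (simp add: riemann_ito_refine[OF nm] d_def riemann_ito_def[of _ _ _ "n * m"]
            left_diff_distrib sum_subtractf)
  qed
  also have "\<dots> = ennreal (\<Sum>j<n * m. (d j)\<^sup>2 * (?g (Suc j) - ?g j))"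
    by (rule centred_normal_second_moment[OF cn])
  also have "\<dots> \<le> ennreal (\<Sum>j<n * m. (L * T / real n)\<^sup>2 * (?g (Suc j) - ?g j))"
  proof (intro ennreal_leI sum_mono mult_right_mono)
    show "(d j)\<^sup>2 \<le> (L * T / real n)\<^sup>2" if "j \<in> {..<n * m}" for j
      using power_mono[OF d[of j], of 2] that by simp
    show "0 \<le> ?g (Suc j) - ?g j" for j using grid_mono[of T "n * m" j] T by simp
  qed
  also have "(\<Sum>j<n * m. (L * T / real n)\<^sup>2 * (?g (Suc j) - ?g j)) = (L * T / real n)\<^sup>2 * T"
    unfolding sum_distrib_left[symmetric] sum_lessThan_telescope using nm by simp
  finally show ?thesis .
qed

text \<open>Let \<open>m\<close> tend to infinity in the preceding bound: the finer sums converge to the integral pathwise,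
and Fatou's lemma transfers the bound to the limit.\<close>

lemma wiener_riemann_mean_square:
  assumes T: "0 \<le> T" and n: "0 < n"
    and L: "\<And>x y. x \<in> {0..T} \<Longrightarrow> y \<in> {0..T} \<Longrightarrow> \<bar>f x - f y\<bar> \<le> L * \<bar>x - y\<bar>" and L0: "0 \<le> L"
  shows "(\<integral>\<^sup>+\<omega>. ennreal ((wiener f f' T \<omega> - riemann_ito f (\<lambda>t. W t \<omega>) T n)\<^sup>2) \<partial>M)
    \<le> ennreal ((L * T / real n)\<^sup>2 * T)"
proof (cases "T = 0")
  case True
  have "(\<integral>\<^sup>+\<omega>. ennreal ((wiener f f' T \<omega> - riemann_ito f (\<lambda>t. W t \<omega>) T n)\<^sup>2) \<partial>M) = (\<integral>\<^sup>+\<omega>. 0 \<partial>M)"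
    by (rule nn_integral_cong) (simp add: True wiener_def riemann_ito_def grid_def W_0)
  then show ?thesis by simp
next
  case False
  let ?R = "\<lambda>k \<omega>. riemann_ito f (\<lambda>t. W t \<omega>) T k"
  have [measurable]: "?R k \<in> borel_measurable M" for k
    using riemann_measurable_F[OF T] measurable_F_imp[OF T] by blast
  have sub: "filterlim (\<lambda>m. n * Suc m) at_top sequentially"
    by (rule filterlim_subseq) (use n in \<open>auto simp: strict_mono_def\<close>)
  have "(\<integral>\<^sup>+\<omega>. ennreal ((wiener f f' T \<omega> - ?R n \<omega>)\<^sup>2) \<partial>M)
      = (\<integral>\<^sup>+\<omega>. liminf (\<lambda>m. ennreal ((?R (n * Suc m) \<omega> - ?R n \<omega>)\<^sup>2)) \<partial>M)"
  proof (rule nn_integral_cong)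
    fix \<omega> assume "\<omega> \<in> space M"
    then have "(\<lambda>m. ?R (n * Suc m) \<omega>) \<longlonglongrightarrow> wiener f f' T \<omega>"
      by (intro filterlim_compose[OF riemann_tendsto_wiener[OF T] sub])
    then have "(\<lambda>m. ennreal ((?R (n * Suc m) \<omega> - ?R n \<omega>)\<^sup>2)) \<longlonglongrightarrow> ennreal ((wiener f f' T \<omega> - ?R n \<omega>)\<^sup>2)"
      by (intro tendsto_ennrealI tendsto_intros)
    then show "ennreal ((wiener f f' T \<omega> - ?R n \<omega>)\<^sup>2) = liminf (\<lambda>m. ennreal ((?R (n * Suc m) \<omega> - ?R n \<omega>)\<^sup>2))"
      using lim_imp_Liminf trivial_limit_sequentially by metis
  qed
  also have "\<dots> \<le> liminf (\<lambda>m. \<integral>\<^sup>+\<omega>. ennreal ((?R (n * Suc m) \<omega> - ?R n \<omega>)\<^sup>2) \<partial>M)"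
    by (rule nn_integral_liminf) measurable
  also have "\<dots> \<le> liminf (\<lambda>m::nat. ennreal ((L * T / real n)\<^sup>2 * T))"
    using False T n L L0 by (intro Liminf_mono always_eventually allI riemann_refinement_second_moment) auto
  also have "\<dots> = ennreal ((L * T / real n)\<^sup>2 * T)"
    by (rule Liminf_const) simp
  finally show ?thesis .
qed

text \<open>The only half-open grid interval containing \<open>s\<close> has the index \<open>\<lfloor>s * n / T\<rfloor>\<close>.\<close>

lemma elementary_integrand_grid:
  assumes "0 < T" "0 < n" "s \<in> {0..<T}"
  shows "\<exists>i<n. grid T n i \<le> s \<and> s < grid T n (Suc i) \<and>
    elementary_integrand n (grid T n) (\<lambda>i _. g (grid T n i)) s \<omega> = g (grid T n i)"
proof -
  define k where "k = nat \<lfloor>s * real n / T\<rfloor>"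
  have x0: "0 \<le> s * real n / T" using assms by simp
  have iff: "s \<in> {grid T n i..<grid T n (Suc i)} \<longleftrightarrow> i = k" for i
  proof -
    have "s \<in> {grid T n i..<grid T n (Suc i)} \<longleftrightarrow> real i \<le> s * real n / T \<and> s * real n / T < real i + 1"
      using assms by (simp add: grid_def field_simps)
    also have "\<dots> \<longleftrightarrow> \<lfloor>s * real n / T\<rfloor> = int i" by (simp add: floor_eq_iff)
    also have "\<dots> \<longleftrightarrow> i = k" using x0 by (auto simp: k_def)
    finally show ?thesis .
  qed
  have "k < n"
  proof -
    have "s * real n / T < real n" using assms by (simp add: divide_less_eq)
    then have "\<lfloor>s * real n / T\<rfloor> < int n" by (simp add: floor_less_iff)
    then show ?thesis using x0 by (simp add: k_def nat_less_iff)
  qed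
  have "elementary_integrand n (grid T n) (\<lambda>i _. g (grid T n i)) s \<omega> = (\<Sum>i<n. if i = k then g (grid T n i) else 0)"
    unfolding elementary_integrand_def by (rule sum.cong) (use iff in \<open>auto simp: indicator_def\<close>)
  also have "\<dots> = g (grid T n k)" using \<open>k < n\<close> by simp
  finally show ?thesis using \<open>k < n\<close> iff[of k] by auto
qed

text \<open>The Riemann sums are the integrals of the elementary integrands obtained by freezing \<open>f\<close> at
the left end points of the grid. These integrands are within \<open>L * T / n\<close> of \<open>f\<close>, except at the end
point \<open>T\<close>, where they vanish; that point is a null set.\<close>

lemma wiener_has_ito_integral:
  assumes T: "0 \<le> T"
  shows "has_ito_integral M F B T (\<lambda>s \<omega>. f s) (wiener f f' T)"
proof -
  have fc: "continuous_on UNIV f"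
    using f by (intro continuous_at_imp_continuous_on) (auto intro: DERIV_isCont)
  have [measurable]: "f \<in> borel_measurable borel" by (rule borel_measurable_continuous_onI[OF fc])
  obtain L where L0: "0 < L" and L': "\<And>r. r \<in> {0..T} \<Longrightarrow> \<bar>f' r\<bar> \<le> L"
    using compact_imp_bounded[OF compact_continuous_image[OF continuous_on_subset[OF f', of "{0..T}"] compact_Icc]]
    unfolding bounded_pos by auto
  have L: "\<bar>f x - f y\<bar> \<le> L * \<bar>x - y\<bar>" if "x \<in> {0..T}" "y \<in> {0..T}" for x y
    using field_differentiable_bound[OF _ has_field_derivative_at_within[OF f], of "{0..T}" L x y] L' that
    by simp
  obtain C where C0: "0 < C" and C: "\<And>r. r \<in> {0..T} \<Longrightarrow> \<bar>f r\<bar> \<le> C"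
    using compact_imp_bounded[OF compact_continuous_image[OF continuous_on_subset[OF fc, of "{0..T}"] compact_Icc]]
    unfolding bounded_pos by auto
  let ?R = "\<lambda>k \<omega>. riemann_ito f (\<lambda>t. W t \<omega>) T k"
  define bound where "bound k = ennreal ((L * T / real (Suc k))\<^sup>2 * T)" for k
  have bound: "bound \<longlonglongrightarrow> 0"
  proof -
    have "(\<lambda>k. (L * T / real (Suc k))\<^sup>2 * T) \<longlonglongrightarrow> 0\<^sup>2 * T"
      by (intro tendsto_intros LIMSEQ_Suc[OF lim_const_over_n])
    then show ?thesis unfolding bound_def[abs_def] using tendsto_ennrealI by fastforce
  qed
  have fin: "(\<integral>\<^sup>+\<omega>. (\<integral>\<^sup>+s\<in>{0..T}. ennreal ((f s)\<^sup>2) \<partial>lborel) \<partial>M) < \<infinity>"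
  proof -
    have "(\<integral>\<^sup>+s\<in>{0..T}. ennreal ((f s)\<^sup>2) \<partial>lborel) \<le> (\<integral>\<^sup>+s. ennreal (C\<^sup>2) * indicator {0..T} s \<partial>lborel)"
    proof (rule nn_integral_mono)
      show "ennreal ((f s)\<^sup>2) * indicator {0..T} s \<le> ennreal (C\<^sup>2) * indicator {0..T} s" for s
        using power_mono[OF C[of s], of 2] by (auto simp: indicator_def ennreal_leI)
    qed
    also have "\<dots> < \<infinity>" using T by (simp add: nn_integral_cmult_indicator ennreal_mult_less_top)
    finally show ?thesis by (simp add: emeasure_space_1)
  qed
  have approx: "(\<integral>\<^sup>+\<omega>. (\<integral>\<^sup>+s\<in>{0..T}.
      ennreal ((f s - elementary_integrand (Suc k) (grid T (Suc k)) (\<lambda>i _. f (grid T (Suc k) i)) s \<omega>)\<^sup>2) \<partial>lborel) \<partial>M)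
      \<le> bound k" for k
  proof -
    let ?h = "\<lambda>s \<omega>. elementary_integrand (Suc k) (grid T (Suc k)) (\<lambda>i _. f (grid T (Suc k) i)) s \<omega>"
    have "(\<integral>\<^sup>+s\<in>{0..T}. ennreal ((f s - ?h s \<omega>)\<^sup>2) \<partial>lborel) \<le> bound k" for \<omega>
    proof -
      have "(\<integral>\<^sup>+s\<in>{0..T}. ennreal ((f s - ?h s \<omega>)\<^sup>2) \<partial>lborel)
          \<le> (\<integral>\<^sup>+s. ennreal ((L * T / real (Suc k))\<^sup>2) * indicator {0..T} s \<partial>lborel)"
      proof (rule nn_integral_mono_AE)
        show "AE s in lborel. ennreal ((f s - ?h s \<omega>)\<^sup>2) * indicator {0..T} s
           \<le> ennreal ((L * T / real (Suc k))\<^sup>2) * indicator {0..T} s"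
          using AE_lborel_singleton[of T]
        proof eventually_elim
          case (elim s)
          show ?case
          proof (cases "s \<in> {0..T}")
            case True
            then have s: "s \<in> {0..<T}" "0 < T" using elim by auto
            obtain i where i: "i < Suc k" "grid T (Suc k) i \<le> s" "s < grid T (Suc k) (Suc i)"
                "?h s \<omega> = f (grid T (Suc k) i)"
              using elementary_integrand_grid[OF s(2) zero_less_Suc s(1), of k f \<omega>] by blast
            have "grid T (Suc k) i \<in> {0..T}" using i T by (intro grid_in) auto
            then have "\<bar>f s - ?h s \<omega>\<bar> \<le> L * \<bar>s - grid T (Suc k) i\<bar>"
              unfolding i(4) using True by (intro L)
            also have "\<dots> \<le> L * (T / real (Suc k))"
              using i grid_step[of T "Suc k" i] L0 by (intro mult_left_mono) auto
            finally have "\<bar>f s - ?h s \<omega>\<bar> \<le> L * T / real (Suc k)" by simp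
            from power_mono[OF this, of 2] show ?thesis using True by (simp add: ennreal_leI)
          qed simp
        qed
      qed
      also have "\<dots> = bound k" using T
        by (simp add: nn_integral_cmult_indicator bound_def ennreal_mult)
      finally show ?thesis .
    qed
    then have "(\<integral>\<^sup>+\<omega>. (\<integral>\<^sup>+s\<in>{0..T}. ennreal ((f s - ?h s \<omega>)\<^sup>2) \<partial>lborel) \<partial>M) \<le> (\<integral>\<^sup>+\<omega>. bound k \<partial>M)"
      by (intro nn_integral_mono)
    then show ?thesis by (simp add: emeasure_space_1)
  qed
  have ms: "(\<integral>\<^sup>+\<omega>. ennreal ((wiener f f' T \<omega> - elementary_integral B (Suc k) (grid T (Suc k)) (\<lambda>i _. f (grid T (Suc k) i)) \<omega>)\<^sup>2) \<partial>M)
      \<le> bound k" for k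
  proof -
    have "(\<integral>\<^sup>+\<omega>. ennreal ((wiener f f' T \<omega> - elementary_integral B (Suc k) (grid T (Suc k)) (\<lambda>i _. f (grid T (Suc k) i)) \<omega>)\<^sup>2) \<partial>M)
       = (\<integral>\<^sup>+\<omega>. ennreal ((wiener f f' T \<omega> - ?R (Suc k) \<omega>)\<^sup>2) \<partial>M)"
      by (rule nn_integral_cong_AE)
         (use W_eq_B in \<open>eventually_elim, simp add: elementary_integral_def riemann_ito_def\<close>)
    also have "\<dots> \<le> bound k"
      unfolding bound_def using L L0 T by (intro wiener_riemann_mean_square) auto
    finally show ?thesis .
  qed
  have data: "elementary_data M F T (Suc k) (grid T (Suc k)) (\<lambda>i _. f (grid T (Suc k) i))" for k
    using T unfolding elementary_data_def by (auto intro: grid_mono)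
  have lim: "x \<longlonglongrightarrow> 0" if "\<And>k. x k \<le> bound k" for x :: "nat \<Rightarrow> ennreal"
    by (rule tendsto_sandwich[OF _ _ tendsto_const bound]) (use that in auto)
  show ?thesis unfolding has_ito_integral_def
  proof (intro conjI ballI)
    show "(\<lambda>(s, \<omega>). indicator {0..T} s * f s) \<in> borel_measurable (lborel \<Otimes>\<^sub>M M)"
      by measurable
    show "wiener f f' T \<in> borel_measurable M" by (rule wiener_measurable[OF T])
    show "\<exists>n \<tau> e. (\<forall>k::nat. elementary_data M F T (n k) (\<tau> k) (e k)) \<and>
        (\<lambda>k. \<integral>\<^sup>+\<omega>. (\<integral>\<^sup>+s\<in>{0..T}. ennreal ((f s - elementary_integrand (n k) (\<tau> k) (e k) s \<omega>)\<^sup>2) \<partial>lborel) \<partial>M)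
          \<longlonglongrightarrow> 0 \<and>
        (\<lambda>k. \<integral>\<^sup>+\<omega>. ennreal ((wiener f f' T \<omega> - elementary_integral B (n k) (\<tau> k) (e k) \<omega>)\<^sup>2) \<partial>M)
          \<longlonglongrightarrow> 0"
      by (intro exI[of _ "\<lambda>k. Suc k"] exI[of _ "\<lambda>k. grid T (Suc k)"] exI[of _ "\<lambda>k i _. f (grid T (Suc k) i)"]
          conjI allI data lim approx ms)
  qed (use fin in auto)
qed

lemma wiener_ito_integral_process:
  "ito_integral_process M F B (\<lambda>s \<omega>. f s) (wiener f f')"
  unfolding ito_integral_process_def adapted_process_def continuous_process_def
  by (auto intro: wiener_adapted wiener_has_ito_integral wiener_continuous AE_I2)

end
end

section \<open>Linear second-order equations with additive noise\<close>

lemma LBINT_FTC: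
  fixes G h :: "real \<Rightarrow> real"
  assumes "0 \<le> T" "continuous_on {0..T} h"
    and "\<And>t. t \<in> {0..T} \<Longrightarrow> (G has_real_derivative h t) (at t within {0..T})"
  shows "(LBINT s=0..T. h s) = G T - G 0"
proof -
  have "(LBINT s=ereal 0..ereal T. h s) = G T - G 0"
    by (rule interval_integral_FTC_finite)
       (use assms in \<open>auto simp: has_real_derivative_iff_has_vector_derivative\<close>)
  then show ?thesis by (simp add: zero_ereal_def)
qed

lemma LBINT_has_derivative:
  fixes h :: "real \<Rightarrow> real"
  assumes "t \<in> {0..T}" "continuous_on {0..T} h"
  shows "((\<lambda>u. LBINT s=0..u. h s) has_real_derivative h t) (at t within {0..T})"
  using interval_integral_FTC2[of 0 0 T h t] assms
  by (simp add: has_real_derivative_iff_has_vector_derivative zero_ereal_def)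

text \<open>A fundamental system \<open>w1\<close>, \<open>w2\<close> of \<open>w'' = 2 g w\<close> with normalized Wronskian; \<open>p1\<close>, \<open>p2\<close> are the
derivatives.\<close>

locale fundamental_system =
  fixes g w1 w2 p1 p2 :: "real \<Rightarrow> real"
  assumes g_cont: "continuous_on UNIV g"
    and w1: "\<And>t. (w1 has_real_derivative p1 t) (at t)"
    and w2: "\<And>t. (w2 has_real_derivative p2 t) (at t)"
    and p1: "\<And>t. (p1 has_real_derivative 2 * g t * w1 t) (at t)"
    and p2: "\<And>t. (p2 has_real_derivative 2 * g t * w2 t) (at t)"
    and wronskian: "\<And>t. w1 t * p2 t - p1 t * w2 t = 1"
begin

lemma w_continuous:
  "continuous_on S w1" "continuous_on S w2" "continuous_on S p1" "continuous_on S p2"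
  by (auto intro!: continuous_at_imp_continuous_on DERIV_isCont w1 w2 p1 p2)

text \<open>For a smooth forcing term \<open>b'\<close> the classical formula is \<open>X t = w2 t * \<integral> w1 b' - w1 t * \<integral> w2 b'\<close>.
Integrating by parts removes \<open>b'\<close>, the boundary terms cancel, and the resulting formula solves the
integral equations for every continuous \<open>b\<close> with \<open>b 0 = 0\<close>. The normalization of the Wronskian produces
the summand \<open>b\<close> of \<open>X' = V\<close>.\<close>

lemma variation_of_constants:
  fixes b X V :: "real \<Rightarrow> real"
  assumes b: "continuous_on {0..T} b" and T: "0 \<le> T" and b0: "b 0 = 0"
    and X: "\<And>t. t \<in> {0..T} \<Longrightarrow>
      X t = w1 t * integral {0..t} (\<lambda>s. p2 s * b s) - w2 t * integral {0..t} (\<lambda>s. p1 s * b s)"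
    and V: "\<And>t. t \<in> {0..T} \<Longrightarrow>
      V t = b t + (p1 t * integral {0..t} (\<lambda>s. p2 s * b s) - p2 t * integral {0..t} (\<lambda>s. p1 s * b s))"
  shows "X T = (LBINT s=0..T. V s)" "V T = (LBINT s=0..T. 2 * g s * X s) + b T"
proof -
  define A1 where "A1 t = integral {0..t} (\<lambda>s. p1 s * b s)" for t
  define A2 where "A2 t = integral {0..t} (\<lambda>s. p2 s * b s)" for t
  define x where "x t = w1 t * A2 t - w2 t * A1 t" for t
  define u where "u t = p1 t * A2 t - p2 t * A1 t" for t
  have A1: "(A1 has_real_derivative p1 t * b t) (at t within {0..T})" if "t \<in> {0..T}" for t
    unfolding A1_def[abs_def]
    by (rule integral_has_real_derivative[OF _ that]) (intro continuous_intros b w_continuous)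
  have A2: "(A2 has_real_derivative p2 t * b t) (at t within {0..T})" if "t \<in> {0..T}" for t
    unfolding A2_def[abs_def]
    by (rule integral_has_real_derivative[OF _ that]) (intro continuous_intros b w_continuous)
  note at = has_field_derivative_at_within
  have x: "(x has_real_derivative b t + u t) (at t within {0..T})" if t: "t \<in> {0..T}" for t
  proof -
    have "(x has_real_derivative (p1 t * A2 t + p2 t * b t * w1 t) - (p2 t * A1 t + p1 t * b t * w2 t))
        (at t within {0..T})"
      unfolding x_def[abs_def]
      by (intro DERIV_diff DERIV_mult A1 A2 t at[OF w1] at[OF w2])
    also have "(p1 t * A2 t + p2 t * b t * w1 t) - (p2 t * A1 t + p1 t * b t * w2 t)
       = b t * (w1 t * p2 t - p1 t * w2 t) + u t" by (simp add: u_def algebra_simps)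
    finally show ?thesis by (simp add: wronskian)
  qed
  have u: "(u has_real_derivative 2 * g t * x t) (at t within {0..T})" if t: "t \<in> {0..T}" for t
  proof -
    have "(u has_real_derivative (2 * g t * w1 t * A2 t + p2 t * b t * p1 t) - (2 * g t * w2 t * A1 t + p1 t * b t * p2 t))
        (at t within {0..T})"
      unfolding u_def[abs_def]
      by (intro DERIV_diff DERIV_mult A1 A2 t at[OF p1] at[OF p2])
    also have "(2 * g t * w1 t * A2 t + p2 t * b t * p1 t) - (2 * g t * w2 t * A1 t + p1 t * b t * p2 t)
       = 2 * g t * x t" by (simp add: x_def algebra_simps)
    finally show ?thesis .
  qed
  have xc: "continuous_on {0..T} x" by (rule DERIV_continuous_on[OF x])
  have uc: "continuous_on {0..T} u" by (rule DERIV_continuous_on[OF u])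
  have Xx: "X t = x t" and Vu: "V t = b t + u t" if "t \<in> {0..T}" for t
    using X[OF that] V[OF that] by (simp_all add: x_def u_def A1_def A2_def)
  have x0: "x 0 = 0" "u 0 = 0" by (simp_all add: x_def u_def A1_def A2_def)
  have "(LBINT s=0..T. V s) = x T - x 0"
  proof (rule LBINT_FTC[OF T])
    show "continuous_on {0..T} V"
      using continuous_on_add[OF b uc] by (rule continuous_on_eq) (simp add: Vu)
  qed (use x Vu in auto)
  then show "X T = (LBINT s=0..T. V s)" using x0 Xx T by simp
  have "(LBINT s=0..T. 2 * g s * X s) = u T - u 0"
  proof (rule LBINT_FTC[OF T])
    have "continuous_on {0..T} (\<lambda>s. 2 * g s * x s)"
      by (intro continuous_intros xc continuous_on_subset[OF g_cont]) auto
    then show "continuous_on {0..T} (\<lambda>s. 2 * g s * X s)"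
      by (rule continuous_on_eq) (simp add: Xx)
  qed (use u Xx in auto)
  then show "V T = (LBINT s=0..T. 2 * g s * X s) + b T" using x0 Vu T by simp
qed

text \<open>The Wronskians of a solution \<open>D\<close> with \<open>w1\<close> and with \<open>w2\<close> are constant, hence zero. This is a linear
system for \<open>D T\<close> and \<open>E T\<close> whose determinant is the Wronskian of \<open>w1\<close> and \<open>w2\<close>.\<close>

lemma homogeneous_zero:
  assumes D: "\<And>t. t \<in> {0..T} \<Longrightarrow> (D has_real_derivative E t) (at t within {0..T})"
    and E: "\<And>t. t \<in> {0..T} \<Longrightarrow> (E has_real_derivative 2 * g t * D t) (at t within {0..T})"
    and 0: "D 0 = 0" "E 0 = 0" and T: "0 \<le> T"
  shows "D T = 0" "E T = 0"
proof -
  note at = has_field_derivative_at_within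
  have c1: "w1 T * E T - p1 T * D T = 0"
  proof -
    have "((\<lambda>t. w1 t * E t - p1 t * D t) has_real_derivative 0) (at t within {0..T})" if "t \<in> {0..T}" for t
      by (rule derivative_eq_intros D E that at[OF w1] at[OF p1] refl)+ simp
    then obtain k where k: "\<And>t. t \<in> {0..T} \<Longrightarrow> w1 t * E t - p1 t * D t = k"
      using has_field_derivative_zero_constant[of "{0..T}" "\<lambda>t. w1 t * E t - p1 t * D t"] by auto
    from k[of 0] k[of T] 0 T show ?thesis by simp
  qed
  have c2: "w2 T * E T - p2 T * D T = 0"
  proof -
    have "((\<lambda>t. w2 t * E t - p2 t * D t) has_real_derivative 0) (at t within {0..T})" if "t \<in> {0..T}" for t
      by (rule derivative_eq_intros D E that at[OF w2] at[OF p2] refl)+ simp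
    then obtain k where k: "\<And>t. t \<in> {0..T} \<Longrightarrow> w2 t * E t - p2 t * D t = k"
      using has_field_derivative_zero_constant[of "{0..T}" "\<lambda>t. w2 t * E t - p2 t * D t"] by auto
    from k[of 0] k[of T] 0 T show ?thesis by simp
  qed
  have "D T = (w1 T * p2 T - p1 T * w2 T) * D T" by (simp add: wronskian)
  also have "\<dots> = w2 T * (w1 T * E T - p1 T * D T) - w1 T * (w2 T * E T - p2 T * D T)"
    by (simp add: algebra_simps)
  finally show "D T = 0" by (simp add: c1 c2)
  have "E T = (w1 T * p2 T - p1 T * w2 T) * E T" by (simp add: wronskian)
  also have "\<dots> = p2 T * (w1 T * E T - p1 T * D T) - p1 T * (w2 T * E T - p2 T * D T)"
    by (simp add: algebra_simps)
  finally show "E T = 0" by (simp add: c1 c2)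
qed

text \<open>The noise cancels in the difference of two solutions, which therefore solves the homogeneous
equation.\<close>

lemma integral_system_unique:
  fixes b X V X' V' :: "real \<Rightarrow> real"
  assumes cont: "continuous_on {0..} X" "continuous_on {0..} V" "continuous_on {0..} X'" "continuous_on {0..} V'"
    and X: "\<And>t. 0 \<le> t \<Longrightarrow> X t = (LBINT s=0..t. V s)"
    and V: "\<And>t. 0 \<le> t \<Longrightarrow> V t = (LBINT s=0..t. 2 * g s * X s) + b t"
    and X': "\<And>t. 0 \<le> t \<Longrightarrow> X' t = (LBINT s=0..t. V' s)"
    and V': "\<And>t. 0 \<le> t \<Longrightarrow> V' t = (LBINT s=0..t. 2 * g s * X' s) + b t"
    and T: "0 \<le> T"
  shows "X' T = X T" "V' T = V T"
proof -
  define D where "D t = (LBINT s=0..t. V' s) - (LBINT s=0..t. V s)" for t :: real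
  define E where "E t = (LBINT s=0..t. 2 * g s * X' s) - (LBINT s=0..t. 2 * g s * X s)" for t :: real
  have DX: "D t = X' t - X t" and EV: "E t = V' t - V t" if "t \<in> {0..T}" for t
    using X X' V V' that by (simp_all add: D_def E_def)
  have c: "continuous_on {0..T} V'" "continuous_on {0..T} V" "continuous_on {0..T} X'" "continuous_on {0..T} X"
    using cont by (auto elim: continuous_on_subset)
  have gX: "continuous_on {0..T} (\<lambda>s. 2 * g s * X' s)" "continuous_on {0..T} (\<lambda>s. 2 * g s * X s)"
    by (intro continuous_intros c continuous_on_subset[OF g_cont]; simp)+
  have D: "(D has_real_derivative E t) (at t within {0..T})" if "t \<in> {0..T}" for t
    unfolding EV[OF that] D_def[abs_def] by (intro DERIV_diff LBINT_has_derivative that c)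
  have E: "(E has_real_derivative 2 * g t * D t) (at t within {0..T})" if "t \<in> {0..T}" for t
    unfolding DX[OF that] E_def[abs_def] right_diff_distrib
    by (intro DERIV_diff LBINT_has_derivative that gX)
  have "D 0 = 0" "E 0 = 0" by (simp_all add: D_def E_def interval_integral_endpoints_same flip: zero_ereal_def)
  note Z = homogeneous_zero[OF D E this T]
  show "X' T = X T" using Z(1) DX T by simp
  show "V' T = V T" using Z(2) EV T by simp
qed

end

context brownian begin

text \<open>The solution is taken as the Wiener integral of the kernel \<open>K t\<close> over \<open>[0, t]\<close>, so that adaptedness,
the Ito representation and the membership in the first chaos are immediate. Linearity of the
integral splits it into the two integrals \<open>J1\<close>, \<open>J2\<close>, which gives continuity in \<open>t\<close> and connects it with
variation of constants.\<close>

theorem linear_second_order_sde: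
  fixes g w1 w2 p1 p2 :: "real \<Rightarrow> real"
  assumes sys: "fundamental_system g w1 w2 p1 p2"
  defines "K \<equiv> (\<lambda>t s. w2 t * w1 s - w1 t * w2 s)"
  shows "\<exists>X V.
     strong_solution M F B g X V \<and>
     (\<forall>X' V'. strong_solution M F B g X' V' \<longrightarrow>
        (AE \<omega> in M. \<forall>t\<ge>0. X' t \<omega> = X t \<omega> \<and> V' t \<omega> = V t \<omega>)) \<and>
     continuous_process M X \<and> gaussian_process M X \<and>
     (\<exists>J\<^sub>1 J\<^sub>2.
        ito_integral_process M F B (\<lambda>s \<omega>. w1 s) J\<^sub>1 \<and>
        ito_integral_process M F B (\<lambda>s \<omega>. w2 s) J\<^sub>2 \<and>
        (AE \<omega> in M. \<forall>t\<ge>0. X t \<omega> = w2 t * J\<^sub>1 t \<omega> - w1 t * J\<^sub>2 t \<omega>)) \<and>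
     (\<forall>t\<ge>0. has_ito_integral M F B t (\<lambda>s \<omega>. K t s) (X t))"
proof -
  interpret fundamental_system g w1 w2 p1 p2 by (rule sys)
  define K' where "K' t s = w2 t * p1 s - w1 t * p2 s" for t s
  have K: "(K t has_real_derivative K' t s) (at s)" for t s
    unfolding K_def K'_def by (intro DERIV_diff DERIV_cmult w1 w2)
  have K': "continuous_on UNIV (K' t)" for t
    unfolding K'_def by (intro continuous_intros w_continuous)
  define J1 where "J1 = wiener w1 p1"
  define J2 where "J2 = wiener w2 p2"
  define X where "X t = wiener (K t) (K' t) t" for t
  define V where "V t \<omega> = p2 t * J1 t \<omega> - p1 t * J2 t \<omega>" for t \<omega>
  define A1 where "A1 t \<omega> = integral {0..t} (\<lambda>s. p1 s * W s \<omega>)" for t \<omega>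
  define A2 where "A2 t \<omega> = integral {0..t} (\<lambda>s. p2 s * W s \<omega>)" for t \<omega>
  have XA: "X t \<omega> = w1 t * A2 t \<omega> - w2 t * A1 t \<omega>" if "\<omega> \<in> space M" for t \<omega>
  proof -
    have "((\<lambda>s. w2 t * (p1 s * W s \<omega>) - w1 t * (p2 s * W s \<omega>)) has_integral
        w2 t * A1 t \<omega> - w1 t * A2 t \<omega>) {0..t}"
      unfolding A1_def A2_def
      by (intro has_integral_diff has_integral_mult_right integrable_integral integrable_continuous_real
          continuous_intros w_continuous W_continuous_Icc that) auto
    then have "integral {0..t} (\<lambda>s. K' t s * W s \<omega>) = w2 t * A1 t \<omega> - w1 t * A2 t \<omega>"
      by (intro integral_unique) (simp add: K'_def left_diff_distrib mult.assoc)
    then show ?thesis by (simp add: X_def wiener_def K_def)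
  qed
  have JA: "J1 t \<omega> = w1 t * W t \<omega> - A1 t \<omega>" "J2 t \<omega> = w2 t * W t \<omega> - A2 t \<omega>" for t \<omega>
    by (simp_all add: J1_def J2_def wiener_def A1_def A2_def)
  have XJ: "X t \<omega> = w2 t * J1 t \<omega> - w1 t * J2 t \<omega>" if "\<omega> \<in> space M" for t \<omega>
    unfolding XA[OF that] JA by (simp add: algebra_simps)
  \<comment> \<open>The Wronskian turns the multiple of \<open>W\<close> into \<open>W\<close> itself, the noise in \<open>dV = 2 g X dt + dB\<close>.\<close>
  have VA: "V t \<omega> = W t \<omega> + (p1 t * A2 t \<omega> - p2 t * A1 t \<omega>)" for t \<omega>
  proof -
    have "V t \<omega> = (w1 t * p2 t - p1 t * w2 t) * W t \<omega> + (p1 t * A2 t \<omega> - p2 t * A1 t \<omega>)"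
      unfolding V_def JA by (simp add: algebra_simps)
    then show ?thesis by (simp add: wronskian)
  qed
  have Jc: "continuous_on {0..} (\<lambda>t. J1 t \<omega>)" "continuous_on {0..} (\<lambda>t. J2 t \<omega>)" if "\<omega> \<in> space M" for \<omega>
    unfolding J1_def J2_def by (intro wiener_continuous w1 w2 w_continuous that)+
  have Xc: "continuous_on {0..} (\<lambda>t. X t \<omega>)" if "\<omega> \<in> space M" for \<omega>
    unfolding XJ[OF that] by (intro continuous_intros w_continuous Jc that)
  have Vc: "continuous_on {0..} (\<lambda>t. V t \<omega>)" if "\<omega> \<in> space M" for \<omega>
    unfolding V_def by (intro continuous_intros w_continuous Jc that)
  have Jad: "J1 t \<in> borel_measurable (F t)" "J2 t \<in> borel_measurable (F t)" if "0 \<le> t" for t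
    unfolding J1_def J2_def by (intro wiener_adapted w1 w2 w_continuous that)+
  have XV0: "X 0 \<omega> = 0" "V 0 \<omega> = 0" if "\<omega> \<in> space M" for \<omega>
    using that by (simp_all add: XA VA A1_def A2_def W_0)
  have sol: "strong_solution M F B g X V"
    unfolding strong_solution_def adapted_process_def continuous_process_def
  proof (intro conjI allI impI)
    show "X t \<in> borel_measurable (F t)" if "0 \<le> t" for t
      unfolding X_def using that by (intro wiener_adapted K K')
    show "V t \<in> borel_measurable (F t)" if "0 \<le> t" for t
      unfolding V_def[abs_def] using Jad[OF that]
      by (intro borel_measurable_diff borel_measurable_times borel_measurable_const)
    show "AE \<omega> in M. \<forall>t\<ge>0. X t \<omega> = (LBINT s=0..t. V s \<omega>) \<and>
        V t \<omega> = (LBINT s=0..t. 2 * g s * X s \<omega>) + B t \<omega>"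
      using W_eq_B AE_space
    proof eventually_elim
      case (elim \<omega>)
      note voc = variation_of_constants[OF W_continuous_Icc[OF elim(2) order_refl] _ W_0[OF elim(2)]
          XA[OF elim(2), unfolded A1_def A2_def] VA[of _ \<omega>, unfolded A1_def A2_def]]
      show ?case using voc elim(1) by simp
    qed
  qed (auto intro!: AE_I2 Xc Vc XV0)
  have uniq: "AE \<omega> in M. \<forall>t\<ge>0. X' t \<omega> = X t \<omega> \<and> V' t \<omega> = V t \<omega>"
    if sol': "strong_solution M F B g X' V'" for X' V'
  proof -
    have "AE \<omega> in M. continuous_on {0..} (\<lambda>t. X t \<omega>)" "AE \<omega> in M. continuous_on {0..} (\<lambda>t. V t \<omega>)"
      "AE \<omega> in M. continuous_on {0..} (\<lambda>t. X' t \<omega>)" "AE \<omega> in M. continuous_on {0..} (\<lambda>t. V' t \<omega>)"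
      "AE \<omega> in M. \<forall>t\<ge>0. X t \<omega> = (LBINT s=0..t. V s \<omega>) \<and> V t \<omega> = (LBINT s=0..t. 2 * g s * X s \<omega>) + B t \<omega>"
      "AE \<omega> in M. \<forall>t\<ge>0. X' t \<omega> = (LBINT s=0..t. V' s \<omega>) \<and> V' t \<omega> = (LBINT s=0..t. 2 * g s * X' s \<omega>) + B t \<omega>"
      using sol sol' by (simp_all add: strong_solution_def continuous_process_def)
    then show ?thesis
    proof eventually_elim
      case (elim \<omega>)
      show ?case
        using integral_system_unique[OF elim(1-4), of "\<lambda>t. B t \<omega>"] elim(5,6) by blast
    qed
  qed
  have gauss: "gaussian_process M X"
    unfolding gaussian_process_def
  proof (intro allI impI)
    fix I :: "real set" and c
    assume "finite I \<and> I \<subseteq> {0..}"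
    then have "(\<lambda>\<omega>. \<Sum>t\<in>I. c t * X t \<omega>) \<in> first_chaos"
      unfolding X_def by (intro first_chaos_sum wiener_first_chaos K K') auto
    then show "gaussian_rv M (\<lambda>\<omega>. \<Sum>t\<in>I. c t * X t \<omega>)" by (rule first_chaos_gaussian)
  qed
  have ito: "has_ito_integral M F B t (\<lambda>s \<omega>. K t s) (X t)" if "0 \<le> t" for t
    unfolding X_def using that by (intro wiener_has_ito_integral K K')
  have J: "ito_integral_process M F B (\<lambda>s \<omega>. w1 s) J1" "ito_integral_process M F B (\<lambda>s \<omega>. w2 s) J2"
    unfolding J1_def J2_def by (intro wiener_ito_integral_process w1 w2 w_continuous)+
  have rep: "AE \<omega> in M. \<forall>t\<ge>0. X t \<omega> = w2 t * J1 t \<omega> - w1 t * J2 t \<omega>"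
    by (intro AE_I2 allI impI XJ)
  show ?thesis
    using sol uniq gauss ito J rep Xc
    by (intro exI[of _ X] exI[of _ V]) (auto simp: continuous_process_def intro!: AE_I2)
qed

end

section \<open>Jacobi elliptic functions and the Lame equation\<close>

locale elliptic_modulus =
  fixes q :: real
  assumes q: "q\<^sup>2 < 1"
begin

lemma delta_pos: "0 < 1 - q\<^sup>2 * (sin x)\<^sup>2"
proof -
  have "q\<^sup>2 * (sin x)\<^sup>2 \<le> q\<^sup>2 * 1"
    by (intro mult_left_mono) (auto simp: abs_square_le_1)
  then show ?thesis using q by simp
qed

lemma elliptic_F_deriv:
  "((\<lambda>\<gamma>. elliptic_F \<gamma> q) has_real_derivative 1 / sqrt (1 - q\<^sup>2 * (sin x)\<^sup>2)) (at x)"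
proof -
  \<comment> \<open>An interval with both \<open>0\<close> and \<open>x\<close> in its interior, for either sign of \<open>x\<close>.\<close>
  define a b where "a = min x 0 - 1" and "b = max x 0 + 1"
  have ab: "a < x" "x < b" "a \<le> 0" "0 \<le> b" by (auto simp: a_def b_def)
  have c: "continuous_on {a..b} (\<lambda>\<alpha>. 1 / sqrt (1 - q\<^sup>2 * (sin \<alpha>)\<^sup>2))"
    using delta_pos by (intro continuous_intros) (auto simp: less_imp_neq[symmetric] simp del: right_minus_eq)
  show ?thesis
    using interval_integral_FTC2[OF ab(3,4) c, of x] ab
    by (simp add: elliptic_F_def has_real_derivative_iff_has_vector_derivative zero_ereal_def
        at_within_Icc_at)
qed

lemma elliptic_F_0 [simp]: "elliptic_F 0 q = 0"
  by (simp add: elliptic_F_def interval_integral_endpoints_same flip: zero_ereal_def)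

lemma elliptic_F_strict_mono: "x < y \<Longrightarrow> elliptic_F x q < elliptic_F y q"
  by (rule DERIV_pos_imp_increasing) (use elliptic_F_deriv delta_pos in fastforce)+

text \<open>The integrand is at least \<open>1\<close>, so that the elliptic integral grows at least linearly in both
directions and is onto.\<close>

lemma elliptic_F_growth: "x \<le> y \<Longrightarrow> elliptic_F x q - x \<le> elliptic_F y q - y"
proof (rule DERIV_nonneg_imp_nondecreasing[where f="\<lambda>x. elliptic_F x q - x"])
  fix x
  have "sqrt (1 - q\<^sup>2 * (sin x)\<^sup>2) \<le> 1" by simp
  then have "0 \<le> 1 / sqrt (1 - q\<^sup>2 * (sin x)\<^sup>2) - 1" using delta_pos[of x] by simp
  then show "\<exists>y. ((\<lambda>x. elliptic_F x q - x) has_real_derivative y) (at x) \<and> 0 \<le> y"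
    by (intro exI[of _ "1 / sqrt (1 - q\<^sup>2 * (sin x)\<^sup>2) - 1"] conjI DERIV_diff elliptic_F_deriv DERIV_ident)
qed

lemma elliptic_F_continuous: "continuous_on S (\<lambda>\<gamma>. elliptic_F \<gamma> q)"
  by (intro continuous_at_imp_continuous_on ballI DERIV_isCont[OF elliptic_F_deriv])

lemma elliptic_F_surj: "\<exists>\<phi>. elliptic_F \<phi> q = u"
proof -
  have "elliptic_F (- \<bar>u\<bar>) q \<le> u" "u \<le> elliptic_F \<bar>u\<bar> q"
    using elliptic_F_growth[of 0 "\<bar>u\<bar>"] elliptic_F_growth[of "- \<bar>u\<bar>" 0] by auto
  then show ?thesis
    using IVT'[of "\<lambda>\<gamma>. elliptic_F \<gamma> q" "- \<bar>u\<bar>" u "\<bar>u\<bar>"] elliptic_F_continuous by auto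
qed

lemma jacobi_am_elliptic_F: "jacobi_am (elliptic_F \<phi> q) q = \<phi>"
  unfolding jacobi_am_def
  by (rule the_equality) (use elliptic_F_strict_mono in \<open>auto, metis linorder_neq_iff\<close>)

text \<open>The amplitude inverts \<open>elliptic_F\<close>, whose derivative at the amplitude is \<open>1 / dn\<close>.\<close>

lemma jacobi_am_deriv: "((\<lambda>u. jacobi_am u q) has_real_derivative jacobi_dn u q) (at u)"
proof -
  obtain \<phi> where \<phi>: "elliptic_F \<phi> q = u" using elliptic_F_surj by blast
  then have am: "jacobi_am u q = \<phi>" using jacobi_am_elliptic_F by blast
  have inv: "elliptic_F (jacobi_am v q) q = v" for v
    using elliptic_F_surj[of v] jacobi_am_elliptic_F by auto
  have "isCont (\<lambda>u. jacobi_am u q) (elliptic_F \<phi> q)"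
    by (rule isCont_inverse_function[of 1, where f="\<lambda>\<gamma>. elliptic_F \<gamma> q"])
       (auto simp: jacobi_am_elliptic_F intro: DERIV_isCont[OF elliptic_F_deriv])
  then have "((\<lambda>u. jacobi_am u q) has_real_derivative inverse (1 / sqrt (1 - q\<^sup>2 * (sin \<phi>)\<^sup>2))) (at u)"
    unfolding \<phi> am[symmetric]
    by (intro DERIV_inverse_function[OF elliptic_F_deriv, of "\<lambda>u. jacobi_am u q" u "u - 1" "u + 1"])
       (use delta_pos[of "jacobi_am u q"] in \<open>auto simp: inv\<close>)
  then show ?thesis by (simp add: jacobi_dn_def jacobi_sn_def am)
qed

abbreviation "sn t \<equiv> jacobi_sn t q"
abbreviation "cn t \<equiv> jacobi_cn t q"
abbreviation "dn t \<equiv> jacobi_dn t q"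

lemma sn_square: "(sn t)\<^sup>2 = 1 - (cn t)\<^sup>2"
  unfolding jacobi_sn_def jacobi_cn_def by (simp add: cos_squared_eq)

lemma dn_square: "(dn t)\<^sup>2 = 1 - q\<^sup>2 * (sn t)\<^sup>2"
  using delta_pos unfolding jacobi_dn_def jacobi_sn_def by (simp add: less_imp_le)

lemma dn_pos: "0 < dn t"
  using delta_pos unfolding jacobi_dn_def jacobi_sn_def by simp

lemma sn_deriv: "((\<lambda>t. sn t) has_real_derivative cn t * dn t) (at t)"
  unfolding jacobi_sn_def jacobi_cn_def by (rule DERIV_chain'[OF jacobi_am_deriv DERIV_sin, THEN DERIV_cong]) simp

lemma cn_deriv: "((\<lambda>t. cn t) has_real_derivative - (sn t * dn t)) (at t)"
  unfolding jacobi_sn_def jacobi_cn_def by (rule DERIV_chain'[OF jacobi_am_deriv DERIV_cos, THEN DERIV_cong]) simp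

lemma dn_deriv: "((\<lambda>t. dn t) has_real_derivative - (q\<^sup>2 * sn t * cn t)) (at t)"
proof -
  have "((\<lambda>t. 1 - q\<^sup>2 * (sn t)\<^sup>2) has_real_derivative - (q\<^sup>2 * (2 * sn t * (cn t * dn t)))) (at t)"
    by (rule derivative_eq_intros sn_deriv refl)+ simp
  moreover have "0 < 1 - q\<^sup>2 * (sn t)\<^sup>2" using delta_pos by (simp add: jacobi_sn_def)
  ultimately have "((\<lambda>t. sqrt (1 - q\<^sup>2 * (sn t)\<^sup>2)) has_real_derivative
      - (q\<^sup>2 * (2 * sn t * (cn t * dn t))) * (inverse (sqrt (1 - q\<^sup>2 * (sn t)\<^sup>2)) / 2)) (at t)"
    by (intro DERIV_chain'[OF _ DERIV_real_sqrt, THEN DERIV_cong]) auto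
  then have "((\<lambda>t. dn t) has_real_derivative - (q\<^sup>2 * (2 * sn t * (cn t * dn t))) * (inverse (dn t) / 2)) (at t)"
    by (simp only: jacobi_dn_def)
  also have "- (q\<^sup>2 * (2 * sn t * (cn t * dn t))) * (inverse (dn t) / 2) = - (q\<^sup>2 * sn t * cn t)"
    using dn_pos[of t] by simp
  finally show ?thesis .
qed

lemma Epsilon_deriv: "((\<lambda>t. jacobi_Epsilon t q) has_real_derivative (dn x)\<^sup>2) (at x)"
proof -
  \<comment> \<open>An interval with both \<open>0\<close> and \<open>x\<close> in its interior, for either sign of \<open>x\<close>.\<close>
  define a b where "a = min x 0 - 1" and "b = max x 0 + 1"
  have ab: "a < x" "x < b" "a \<le> 0" "0 \<le> b" by (auto simp: a_def b_def)
  have c: "continuous_on {a..b} (\<lambda>s. (dn s)\<^sup>2)"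
    by (intro continuous_on_power continuous_at_imp_continuous_on ballI DERIV_isCont[OF dn_deriv])
  show ?thesis
    using interval_integral_FTC2[OF ab(3,4) c, of x] ab
    by (simp add: jacobi_Epsilon_def has_real_derivative_iff_has_vector_derivative zero_ereal_def
        at_within_Icc_at)
qed

text \<open>The coefficient of the Lame equation \<open>u'' = (12 q\<^sup>2 sn\<^sup>2 - 4 (1 + q\<^sup>2)) u\<close>, of which \<open>sn cn dn\<close> is an
elliptic solution.\<close>

definition lame_coeff :: "real \<Rightarrow> real" where
  "lame_coeff t = 12 * q\<^sup>2 * (sn t)\<^sup>2 - 4 * (1 + q\<^sup>2)"

definition u1' :: "real \<Rightarrow> real" where
  "u1' t = (cn t)\<^sup>2 * (dn t)\<^sup>2 - (sn t)\<^sup>2 * (dn t)\<^sup>2 - q\<^sup>2 * (sn t)\<^sup>2 * (cn t)\<^sup>2"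

lemma u1_deriv: "(u1 q has_real_derivative u1' t) (at t)"
  unfolding u1_def[abs_def] u1'_def
  by (rule derivative_eq_intros sn_deriv cn_deriv dn_deriv refl)+
     (simp add: algebra_simps power2_eq_square)

lemma u1'_deriv: "(u1' has_real_derivative lame_coeff t * u1 q t) (at t)"
proof -
  have "(u1' has_real_derivative
      u1 q t * (4 * q\<^sup>2 * (sn t)\<^sup>2 - 4 * q\<^sup>2 * (cn t)\<^sup>2 - 4 * (dn t)\<^sup>2)) (at t)"
    unfolding u1_def u1'_def[abs_def]
    by (rule derivative_eq_intros sn_deriv cn_deriv dn_deriv refl)+
       (simp add: algebra_simps power2_eq_square)
  also have "4 * q\<^sup>2 * (sn t)\<^sup>2 - 4 * q\<^sup>2 * (cn t)\<^sup>2 - 4 * (dn t)\<^sup>2 = lame_coeff t"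
    unfolding lame_coeff_def dn_square sn_square by algebra
  finally show ?thesis by (simp add: mult.commute)
qed

text \<open>The part of \<open>u2\<close> that is not a polynomial in the Jacobi functions is \<open>secular * u1\<close>.\<close>

definition secular :: "real \<Rightarrow> real" where
  "secular t = (- (q^4) + 3 * q\<^sup>2 - 2) * t + 2 * (q^4 - q\<^sup>2 + 1) * jacobi_Epsilon t q"

definition secular' :: "real \<Rightarrow> real" where
  "secular' t = - (q^4) + 3 * q\<^sup>2 - 2 + 2 * (q^4 - q\<^sup>2 + 1) * (dn t)\<^sup>2"

text \<open>With this factor the derivative of \<open>u2\<close> is \<open>u2_factor * u1 + secular * u1'\<close>: the derivatives of
\<open>cn\<^sup>2\<close> and \<open>cn\<^sup>4\<close> contain the factor \<open>u1 = sn cn dn\<close> too.\<close>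

definition u2_factor :: "real \<Rightarrow> real" where
  "u2_factor t = secular' t - 2 * (- 2 * q^6 + 3 * q^4 - 5 * q\<^sup>2 + 2)
     - 8 * q\<^sup>2 * (q^4 - q\<^sup>2 + 1) * (cn t)\<^sup>2"

definition u2' :: "real \<Rightarrow> real" where
  "u2' t = u2_factor t * u1 q t + secular t * u1' t"

lemma secular_deriv: "(secular has_real_derivative secular' t) (at t)"
  unfolding secular_def[abs_def] secular'_def
  by (rule derivative_eq_intros Epsilon_deriv refl)+ simp

lemma secular'_deriv:
  "(secular' has_real_derivative - 4 * q\<^sup>2 * (q^4 - q\<^sup>2 + 1) * u1 q t) (at t)"
  unfolding secular'_def[abs_def] u1_def
  by (rule derivative_eq_intros dn_deriv refl)+ (simp add: algebra_simps)

lemma u2_factor_deriv: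
  "(u2_factor has_real_derivative 12 * q\<^sup>2 * (q^4 - q\<^sup>2 + 1) * u1 q t) (at t)"
  unfolding u2_factor_def[abs_def]
  by (rule derivative_eq_intros secular'_deriv cn_deriv refl)+ (simp add: u1_def algebra_simps)

lemma u2_eq: "u2 q t = (-1 + q\<^sup>2) + (- 2 * q^6 + 3 * q^4 - 5 * q\<^sup>2 + 2) * (cn t)\<^sup>2
    + 2 * q\<^sup>2 * (q^4 - q\<^sup>2 + 1) * (cn t)^4 + secular t * u1 q t"
  by (simp add: u2_def Let_def secular_def)

lemma u2_deriv: "(u2 q has_real_derivative u2' t) (at t)"
  unfolding u2_eq[abs_def] u2'_def u2_factor_def
  by (rule derivative_eq_intros cn_deriv secular_deriv u1_deriv refl)+
     (simp add: u1_def algebra_simps power3_eq_cube power2_eq_square)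

text \<open>The Lame equation for \<open>u2\<close> after the terms with the factor \<open>secular\<close> have cancelled, written in
\<open>C = cn\<^sup>2\<close> and \<open>k = q\<^sup>2\<close> by means of \<open>sn\<^sup>2 = 1 - C\<close> and \<open>dn\<^sup>2 = 1 - k (1 - C)\<close>. The
coefficients of \<open>u2\<close> are chosen to make it true.\<close>

lemma lame_identity:
  fixes C k :: real
  shows "12 * k * (k^2 - k + 1) * ((1 - C) * C * (1 - k * (1 - C)))
    + (((- (k^2) + 3 * k - 2 + 2 * (k^2 - k + 1) * (1 - k * (1 - C)))
        - 2 * (- 2 * k^3 + 3 * k^2 - 5 * k + 2) - 8 * k * (k^2 - k + 1) * C)
       + (- (k^2) + 3 * k - 2 + 2 * (k^2 - k + 1) * (1 - k * (1 - C))))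
      * (C * (1 - k * (1 - C)) - (1 - C) * (1 - k * (1 - C)) - k * (1 - C) * C)
    = (12 * k * (1 - C) - 4 * (1 + k))
      * ((-1 + k) + (- 2 * k^3 + 3 * k^2 - 5 * k + 2) * C + 2 * k * (k^2 - k + 1) * C^2)"
  by (simp add: algebra_simps power2_eq_square power3_eq_cube)

text \<open>The terms with the factor \<open>secular\<close> satisfy the equation because \<open>u1\<close> does; the remaining ones
amount to a polynomial identity.\<close>

lemma u2'_deriv: "(u2' has_real_derivative lame_coeff t * u2 q t) (at t)"
proof -
  have "(u2' has_real_derivative
      12 * q\<^sup>2 * (q^4 - q\<^sup>2 + 1) * (u1 q t)\<^sup>2 + (u2_factor t + secular' t) * u1' t
      + secular t * (lame_coeff t * u1 q t)) (at t)"
    unfolding u2'_def[abs_def]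
    by (rule derivative_eq_intros u2_factor_deriv secular_deriv u1_deriv u1'_deriv refl)+
       (simp add: algebra_simps power2_eq_square)
  also have "12 * q\<^sup>2 * (q^4 - q\<^sup>2 + 1) * (u1 q t)\<^sup>2 + (u2_factor t + secular' t) * u1' t
      = lame_coeff t * ((-1 + q\<^sup>2) + (- 2 * q^6 + 3 * q^4 - 5 * q\<^sup>2 + 2) * (cn t)\<^sup>2
        + 2 * q\<^sup>2 * (q^4 - q\<^sup>2 + 1) * (cn t)^4)"
  proof -
    define k C where "k = q\<^sup>2" and "C = (cn t)\<^sup>2"
    have pow: "q^4 = k^2" "q^6 = k^3" "(cn t)^4 = C^2" "(cn t)\<^sup>2 = C" "q\<^sup>2 = k"
      by (simp_all add: k_def C_def flip: power_mult)
    have S: "(sn t)\<^sup>2 = 1 - C" and D: "(dn t)\<^sup>2 = 1 - k * (1 - C)"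
      by (simp_all add: dn_square sn_square k_def C_def)
    have U: "(u1 q t)\<^sup>2 = (1 - C) * C * (1 - k * (1 - C))"
      unfolding u1_def power_mult_distrib S D pow ..
    show ?thesis
      unfolding U u2_factor_def secular'_def u1'_def lame_coeff_def S D pow
      by (rule lame_identity)
  qed
  finally show ?thesis unfolding u2_eq by (simp add: algebra_simps)
qed

end

section \<open>The stochastic Lame equation\<close>

text \<open>Substituting \<open>r t + i\<^sub>y\<close> with \<open>r\<^sup>2 = (a - c) / 6\<close> multiplies the Lame coefficient by \<open>r\<^sup>2\<close>. The
definition of the modulus, \<open>q\<^sup>2 (c - a) = 2 c + a\<close>, turns the product into \<open>2 x0\<close>. The
conditions on \<open>a\<close> and \<open>c\<close> guarantee \<open>0 < q\<^sup>2 < 1\<close>.\<close>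

lemma lame_fundamental_system:
  fixes a c y \<kappa>\<^sub>1 \<kappa>\<^sub>2 :: real
  assumes "c < 0" "0 < a" "2 * c + a < 0" "- a - c < a"
    and wronskian: "\<And>t. w1 \<kappa>\<^sub>1 a c y t * deriv (w2 \<kappa>\<^sub>2 a c y) t
                         - deriv (w1 \<kappa>\<^sub>1 a c y) t * w2 \<kappa>\<^sub>2 a c y t = 1"
  shows "\<exists>p1 p2. fundamental_system (x0 a c y) (w1 \<kappa>\<^sub>1 a c y) (w2 \<kappa>\<^sub>2 a c y) p1 p2"
proof -
  define q where "q = modulus_q a c"
  define r where "r = sqrt ((a - c) / 6)"
  define l where "l t = r * t + i_y a c y" for t
  have q2: "q\<^sup>2 = (2 * c + a) / (c - a)"
    using assms unfolding q_def modulus_q_def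
    by (intro real_sqrt_pow2) (simp add: divide_nonpos_neg)
  have r2: "r\<^sup>2 = (a - c) / 6"
    using assms by (simp add: r_def)
  interpret elliptic_modulus q
    by unfold_locales (use assms in \<open>simp add: q2 divide_less_eq\<close>)
  have l: "(l has_real_derivative r) (at t)" for t
    unfolding l_def[abs_def] by (rule derivative_eq_intros refl)+ simp
  have chain: "((\<lambda>t. k * f (l t)) has_real_derivative k * (r * f' (l t))) (at t)"
    if "\<And>t. (f has_real_derivative f' t) (at t)" for f f' k t
    using DERIV_chain2[OF that l, of t] by (intro DERIV_cmult) (simp add: mult.commute)
  have lame: "r\<^sup>2 * lame_coeff (l t) = 2 * x0 a c y t" for t
  proof -
    have k: "q\<^sup>2 * (c - a) = 2 * c + a" using assms by (simp add: q2)
    have "r\<^sup>2 * lame_coeff (l t)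
        = 2 / 3 * ((c - a) + q\<^sup>2 * (c - a)) - 2 * (q\<^sup>2 * (c - a)) * (sn (l t))\<^sup>2"
      unfolding lame_coeff_def r2 by (simp add: field_simps)
    also have "\<dots> = 2 * (c - (a + 2 * c) * (sn (l t))\<^sup>2)"
      unfolding k by (simp add: algebra_simps)
    finally show ?thesis by (simp add: x0_def q_def l_def r_def)
  qed
  define p1 where "p1 t = \<kappa>\<^sub>1 * (r * u1' (l t))" for t
  define p2 where "p2 t = \<kappa>\<^sub>2 * (r * u2' (l t))" for t
  have w1_eq: "w1 \<kappa>\<^sub>1 a c y = (\<lambda>t. \<kappa>\<^sub>1 * u1 q (l t))" and w2_eq: "w2 \<kappa>\<^sub>2 a c y = (\<lambda>t. \<kappa>\<^sub>2 * u2 q (l t))"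
    by (auto simp: w1_def w2_def q_def l_def r_def)
  have d1: "(w1 \<kappa>\<^sub>1 a c y has_real_derivative p1 t) (at t)" for t
    unfolding w1_eq p1_def by (rule chain[OF u1_deriv])
  have d2: "(w2 \<kappa>\<^sub>2 a c y has_real_derivative p2 t) (at t)" for t
    unfolding w2_eq p2_def by (rule chain[OF u2_deriv])
  have e1: "(p1 has_real_derivative 2 * x0 a c y t * w1 \<kappa>\<^sub>1 a c y t) (at t)" for t
    using chain[of u1' "\<lambda>t. lame_coeff t * u1 q t" "\<kappa>\<^sub>1 * r" t, OF u1'_deriv]
    unfolding lame[symmetric] w1_eq p1_def[abs_def] by (simp add: power2_eq_square mult_ac)
  have e2: "(p2 has_real_derivative 2 * x0 a c y t * w2 \<kappa>\<^sub>2 a c y t) (at t)" for t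
    using chain[of u2' "\<lambda>t. lame_coeff t * u2 q t" "\<kappa>\<^sub>2 * r" t, OF u2'_deriv]
    unfolding lame[symmetric] w2_eq p2_def[abs_def] by (simp add: power2_eq_square mult_ac)
  have "x0 a c y = (\<lambda>t. c - (a + 2 * c) * (sn (l t))\<^sup>2)"
    by (auto simp: x0_def q_def l_def r_def)
  moreover have "isCont (\<lambda>t. c - (a + 2 * c) * (sn (l t))\<^sup>2) t" for t
    by (intro continuous_intros isCont_o2[OF DERIV_isCont[OF l] DERIV_isCont[OF sn_deriv]])
  ultimately have "continuous_on UNIV (x0 a c y)"
    by (simp add: continuous_at_imp_continuous_on)
  then have "fundamental_system (x0 a c y) (w1 \<kappa>\<^sub>1 a c y) (w2 \<kappa>\<^sub>2 a c y) p1 p2"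
    using d1 d2 e1 e2 wronskian
    by unfold_locales (simp_all add: DERIV_imp_deriv[OF d1] DERIV_imp_deriv[OF d2])
  then show ?thesis by blast
qed

theorem theorem2p2:
  fixes a c y \<kappa>\<^sub>1 \<kappa>\<^sub>2 :: real
    and M :: "'a measure"
    and B :: "real \<Rightarrow> 'a \<Rightarrow> real"
  assumes "c < 0" and "0 < a" and "2 * c + a < 0"
    and "c < - a - c" and "- a - c < a"
    and "y \<in> {c..- a - c}"
    and "\<kappa>\<^sub>1 \<noteq> 0" and "\<kappa>\<^sub>2 \<noteq> 0"
    and wronskian: "\<And>t. w1 \<kappa>\<^sub>1 a c y t * deriv (w2 \<kappa>\<^sub>2 a c y) t
                         - deriv (w1 \<kappa>\<^sub>1 a c y) t * w2 \<kappa>\<^sub>2 a c y t = 1"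
    and "prob_space M" and "complete_measure M"
    and "brownian_motion M B"
  defines "F \<equiv> brownian_filtration M B"
    and "K \<equiv> (\<lambda>t s. w2 \<kappa>\<^sub>2 a c y t * w1 \<kappa>\<^sub>1 a c y s - w1 \<kappa>\<^sub>1 a c y t * w2 \<kappa>\<^sub>2 a c y s)"
  shows "\<exists>X V.
     strong_solution M F B (x0 a c y) X V \<and>
     (\<forall>X' V'. strong_solution M F B (x0 a c y) X' V' \<longrightarrow>
        (AE \<omega> in M. \<forall>t\<ge>0. X' t \<omega> = X t \<omega> \<and> V' t \<omega> = V t \<omega>)) \<and>
     continuous_process M X \<and> gaussian_process M X \<and>
     (\<exists>J\<^sub>1 J\<^sub>2.
        ito_integral_process M F B (\<lambda>s \<omega>. w1 \<kappa>\<^sub>1 a c y s) J\<^sub>1 \<and>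
        ito_integral_process M F B (\<lambda>s \<omega>. w2 \<kappa>\<^sub>2 a c y s) J\<^sub>2 \<and>
        (AE \<omega> in M. \<forall>t\<ge>0.
           X t \<omega> = w2 \<kappa>\<^sub>2 a c y t * J\<^sub>1 t \<omega> - w1 \<kappa>\<^sub>1 a c y t * J\<^sub>2 t \<omega>)) \<and>
     (\<forall>t\<ge>0. has_ito_integral M F B t (\<lambda>s \<omega>. K t s) (X t))"
proof -
  interpret prob_space M by fact
  interpret brownian M B by unfold_locales fact
  obtain p1 p2 where "fundamental_system (x0 a c y) (w1 \<kappa>\<^sub>1 a c y) (w2 \<kappa>\<^sub>2 a c y) p1 p2"
    using lame_fundamental_system[OF assms(1-3,5) wronskian] by blast
  from linear_second_order_sde[OF this] show ?thesis
    unfolding F_def K_def .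
qed

end
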